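(* There is an absolute constant $C>0$ such that the following holds. Let $d,n$ be positive integers with $e^{\sqrt d}\ge n\log n\ge d$, and let $Q,K,V\in\mathbb R^{d\times d}$ satisfy $\max\{\|Q^\top K\|_{op},\|V\|_{op}\}\le1$. Let $\beta=1$, let $\theta_1,\dots,\theta_n$ be i.i.d. uniform on the unit sphere $\mathbb S^{d-1}$, and set $$A_j=\frac1{Z_j}\sum_{k=1}^n e^{\beta\langle Q\theta_j,K\theta_k\rangle}V\theta_k,\qquad Z_j=\sum_{k=1}^n e^{\beta\langle Q\theta_j,K\theta_k\rangle}.$$ Then, with probability at least $1-n^{-C}$, simultaneously for all $j\in\{1,\dots,n\}$, $$\|A_j\|\le C\left(\sqrt{\frac{\log n}{n}}+\frac{\log n}{d}\right).$$
   Context: $\|\cdot\|$ is the Euclidean norm and $\|\cdot\|_{op}$ the operator (spectral) norm. The matrices $Q,K,V$ are deterministic. *)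

theory Defs
  imports
    "HOL-Probability.Probability"
    "Jordan_Normal_Form.Matrix"
begin

(* The constant of the theorem must not depend on d, so R^d cannot be a type real^'d (HOL cannot
   quantify over types inside a formula). Vectors and matrices are those of Jordan_Normal_Form,
   whose dimension is a term: carrier_vec d is R^d and carrier_mat d d is R^(d x d). *)

text \<open>HOL-Analysis uses the same symbols for its type-indexed vectors.\<close>
no_notation vec_nth (infixl \<open>$\<close> 90)
hide_type (open) Finite_Cartesian_Product.vec
hide_const (open) Finite_Cartesian_Product.vec

definition eucl_norm :: "real vec \<Rightarrow> real" where
  "eucl_norm v = sqrt (v \<bullet> v)"

definition op_norm :: "real mat \<Rightarrow> real" where
  "op_norm A = Sup {eucl_norm (A *\<^sub>v x) | x. x \<in> carrier_vec (dim_col A) \<and> eucl_norm x \<le> 1}"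

text \<open>The Borel sigma-algebra of \<open>\<real>\<^sup>d\<close>, i.e. the one generated by the \<open>d\<close> coordinate maps.\<close>

definition borel_vec :: "nat \<Rightarrow> real vec measure" where
  "borel_vec d = vimage_algebra (carrier_vec d) (\<lambda>v. \<lambda>i\<in>{..<d}. v $ i) (\<Pi>\<^sub>M i\<in>{..<d}. borel)"

definition lborel_vec :: "nat \<Rightarrow> real vec measure" where
  "lborel_vec d = distr (\<Pi>\<^sub>M i\<in>{..<d}. lborel) (borel_vec d) (Matrix.vec d)"

text \<open>
  The uniform distribution on the unit sphere of \<open>\<real>\<^sup>d\<close>, i.e. normalised surface measure (cone
  measure): the radial projection \<open>x / \<parallel>x\<parallel>\<close> of a uniform point \<open>x\<close> of the unit ball. The origin,
  where the projection is undefined, is a null set.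
\<close>

definition unif_sphere :: "nat \<Rightarrow> real vec measure" where
  "unif_sphere d =
     distr (uniform_measure (lborel_vec d) {x \<in> carrier_vec d. eucl_norm x \<le> 1})
       (borel_vec d) (\<lambda>x. (1 / eucl_norm x) \<cdot>\<^sub>v x)"

text \<open>
  The joint law of \<open>\<theta> 1, \<dots>, \<theta> n\<close>; \<open>\<theta> k\<close> is the \<open>k\<close>-th coordinate map. Working on the canonical
  probability space loses nothing, as only the joint law matters, and it keeps constants independent
  of the type of an underlying probability space.
\<close>

definition iid_sphere :: "nat \<Rightarrow> nat \<Rightarrow> (nat \<Rightarrow> real vec) measure" where
  "iid_sphere d n = (\<Pi>\<^sub>M k\<in>{1..n}. unif_sphere d)"

definition attn_weight ::
  "real \<Rightarrow> real mat \<Rightarrow> real mat \<Rightarrow> (nat \<Rightarrow> real vec) \<Rightarrow> nat \<Rightarrow> nat \<Rightarrow> real" where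
  "attn_weight \<beta> Q K \<theta> j k = exp (\<beta> * ((Q *\<^sub>v \<theta> j) \<bullet> (K *\<^sub>v \<theta> k)))"

definition attn_Z ::
  "real \<Rightarrow> real mat \<Rightarrow> real mat \<Rightarrow> nat \<Rightarrow> (nat \<Rightarrow> real vec) \<Rightarrow> nat \<Rightarrow> real" where
  "attn_Z \<beta> Q K n \<theta> j = (\<Sum>k=1..n. attn_weight \<beta> Q K \<theta> j k)"

definition attn ::
  "real \<Rightarrow> real mat \<Rightarrow> real mat \<Rightarrow> real mat \<Rightarrow> nat \<Rightarrow> (nat \<Rightarrow> real vec) \<Rightarrow> nat \<Rightarrow> real vec" where
  "attn \<beta> Q K V n \<theta> j =
     (1 / attn_Z \<beta> Q K n \<theta> j) \<cdot>\<^sub>v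
       finsum_vec TYPE(real) (dim_row V) (\<lambda>k. attn_weight \<beta> Q K \<theta> j k \<cdot>\<^sub>v (V *\<^sub>v \<theta> k)) {1..n}"

end

theory Submission
  imports Defs
begin

text \<open>
  Condition on \<open>\<theta>\<^sub>j\<close> and write \<open>w = (Q\<^sup>T K)\<^sup>T \<theta>\<^sub>j\<close>, so that \<open>\<parallel>w\<parallel> \<le> 1\<close> and the weights are \<open>exp \<langle>w, \<theta>\<^sub>k\<rangle>\<close>.
  As \<open>Z\<^sub>j \<ge> n / e\<close> and \<open>\<parallel>V\<parallel> \<le> 1\<close>, it suffices to bound \<open>(1 / n) \<Sum>\<^sub>k exp \<langle>w, \<theta>\<^sub>k\<rangle> \<theta>\<^sub>k\<close>. The term \<open>k = j\<close> is
  \<open>O(1 / n)\<close>. The other terms are i.i.d. with mean of norm \<open>O(1 / d)\<close>, by isotropy of the sphere; their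
  fluctuation is \<open>O(sqrt (log n / n))\<close> by a dimension-free Hoeffding inequality, which follows from
  \<open>E cosh \<parallel>a + Y\<parallel> \<le> cosh \<parallel>a\<parallel> cosh B\<close> for centred \<open>Y\<close> with \<open>\<parallel>Y\<parallel> \<le> B\<close>, itself a consequence of the
  convexity of \<open>t \<mapsto> cosh (sqrt t)\<close>. A union bound over \<open>j\<close> concludes.
\<close>

section \<open>Power series bounds for the hyperbolic cosine\<close>

text \<open>The odd terms of the series vanish, which leaves a power series in
  \<open>x\<^sup>2\<close> with nonnegative coefficients. Convexity and the Gaussian bound on
  \<open>cosh\<close> below are both read off termwise from it.\<close>

lemma cosh_sums_square:
  fixes x :: real
  shows "(\<lambda>k. (x\<^sup>2) ^ k / fact (2 * k)) sums cosh x"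
proof -
  have "(\<lambda>k. (\<lambda>n. if even n then x ^ n /\<^sub>R fact n else 0) (2 * k)) sums cosh x"
    by (subst sums_mono_reindex)
      (auto simp: strict_mono_def cosh_converges elim!: evenE)
  then show ?thesis
    by (simp add: power_mult divide_inverse mult.commute[of "inverse _"])
qed

text \<open>As a series in \<open>t\<close>, \<open>cosh (sqrt t)\<close> has nonnegative
  coefficients, and each monomial is convex on the half-line.\<close>

lemma convex_on_cosh_sqrt: "convex_on {0..} (\<lambda>t. cosh (sqrt t) :: real)"
proof (rule convex_onI)
  fix t x y :: real
  assume t: "0 < t" "t < 1" and xy: "x \<in> {0..}" "y \<in> {0..}"
  have S: "(\<lambda>k. z ^ k / fact (2 * k)) sums cosh (sqrt z)" if "0 \<le> z" for z :: real
    using cosh_sums_square[of "sqrt z"] that by simp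
  have pow: "((1 - t) * x + t * y) ^ k \<le> (1 - t) * x ^ k + t * y ^ k" for k
  proof (cases "even k")
    case True
    with convex_onD[OF convex_power_even[OF True], of t x y] t show ?thesis
      by simp
  next
    case False
    with convex_onD[OF convex_power_odd[OF False], of t x y] t xy show ?thesis
      by simp
  qed
  have le: "cosh (sqrt ((1 - t) * x + t * y)) \<le> (1 - t) * cosh (sqrt x) + t * cosh (sqrt y)"
  proof (rule sums_le)
    show "(\<lambda>k. ((1 - t) * x + t * y) ^ k / fact (2 * k)) sums cosh (sqrt ((1 - t) * x + t * y))"
      using t xy by (intro S) auto
    show "(\<lambda>k. (1 - t) * (x ^ k / fact (2 * k)) + t * (y ^ k / fact (2 * k))) sums
        ((1 - t) * cosh (sqrt x) + t * cosh (sqrt y))"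
      using xy by (intro sums_add sums_mult S) auto
    show "((1 - t) * x + t * y) ^ k / fact (2 * k) \<le>
        (1 - t) * (x ^ k / fact (2 * k)) + t * (y ^ k / fact (2 * k))" for k
      using divide_right_mono[OF pow[of k], of "fact (2 * k)"] by (simp add: add_divide_distrib)
  qed
  then show "cosh (sqrt ((1 - t) *\<^sub>R x + t *\<^sub>R y)) \<le> (1 - t) * cosh (sqrt x) + t * cosh (sqrt y)"
    by simp
qed simp

text \<open>The two series compare termwise because
  \<open>2 ^ k * fact k \<le> fact (2 * k)\<close>. The bound later turns a product of
  \<open>cosh\<close> factors into a Gaussian moment bound.\<close>

lemma cosh_le_exp_square_half:
  fixes x :: real
  shows "cosh x \<le> exp (x\<^sup>2 / 2)"
proof (rule sums_le)
  show "(\<lambda>k. (x\<^sup>2) ^ k / fact (2 * k)) sums cosh x"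
    by (rule cosh_sums_square)
  show "(\<lambda>k. (x\<^sup>2 / 2) ^ k /\<^sub>R fact k) sums exp (x\<^sup>2 / 2)"
    by (rule exp_converges)
  fix k
  have "(2::real) ^ k * fact k \<le> fact (2 * k)"
  proof (induction k)
    case (Suc k)
    have "(2::real) ^ Suc k * fact (Suc k) = (2 * real (Suc k)) * (2 ^ k * fact k)"
      by simp
    also have "\<dots> \<le> (real (2 * k + 2) * real (2 * k + 1)) * fact (2 * k)"
    proof (rule mult_mono[OF _ Suc])
      show "2 * real (Suc k) \<le> real (2 * k + 2) * real (2 * k + 1)"
        by (simp add: algebra_simps)
    qed auto
    also have "\<dots> = fact (2 * Suc k)"
      by (simp add: algebra_simps)
    finally show ?case .
  qed simp
  then have "(x\<^sup>2) ^ k / fact (2 * k) \<le> (x\<^sup>2) ^ k / (2 ^ k * fact k)"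
    by (intro divide_left_mono) auto
  moreover have "(x\<^sup>2 / 2) ^ k /\<^sub>R fact k = (x\<^sup>2) ^ k / (2 ^ k * fact k)"
    unfolding power_divide by (simp add: field_simps)
  ultimately show "(x\<^sup>2) ^ k / fact (2 * k) \<le> (x\<^sup>2 / 2) ^ k /\<^sub>R fact k"
    by (simp only:)
qed

lemma abs_sum_mult_le_L2_set: "\<bar>\<Sum>i\<in>D. x i * y i\<bar> \<le> L2_set x D * L2_set y D"
proof -
  have "\<bar>\<Sum>i\<in>D. x i * y i\<bar> \<le> (\<Sum>i\<in>D. \<bar>x i\<bar> * \<bar>y i\<bar>)"
    by (rule order_trans[OF sum_abs]) (simp add: abs_mult)
  with L2_set_mult_ineq[of x y D] show ?thesis
    by linarith
qed

lemma L2_set_power2: "(L2_set x D)\<^sup>2 = (\<Sum>i\<in>D. (x i)\<^sup>2)"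
  by (simp add: L2_set_def sum_nonneg)

text \<open>The bound is affine in \<open>y\<close>, so it survives averaging over a centred \<open>y\<close>. The junk value
  \<open>z / 0 = 0\<close> is correct here, since the inner product then vanishes.\<close>

lemma cosh_L2_set_add_le:
  assumes "L2_set y D \<le> B"
  shows "cosh (L2_set (\<lambda>i. x i + y i) D) \<le> cosh (L2_set x D) * cosh B +
    sinh (L2_set x D) / L2_set x D * (sinh B / B) * (\<Sum>i\<in>D. x i * y i)"
proof -
  define a where "a = L2_set x D"
  define p where "p = (\<Sum>i\<in>D. x i * y i)"
  define u where "u = L2_set (\<lambda>i. x i + y i) D"
  have a0: "0 \<le> a" and b0: "0 \<le> L2_set y D" and B0: "0 \<le> B" and u0: "0 \<le> u"
    using assms order_trans[OF L2_set_nonneg assms] by (auto simp: a_def u_def)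
  have "\<bar>p\<bar> \<le> a * L2_set y D"
    unfolding p_def a_def by (rule abs_sum_mult_le_L2_set)
  also have "\<dots> \<le> a * B"
    using a0 assms by (intro mult_left_mono)
  finally have p: "\<bar>p\<bar> \<le> a * B" .
  have "u\<^sup>2 = a\<^sup>2 + 2 * p + (L2_set y D)\<^sup>2"
    unfolding u_def a_def p_def L2_set_power2
    by (simp add: power2_sum sum.distrib sum_distrib_left algebra_simps)
  \<comment> \<open>Here the length of \<open>y\<close> is replaced by \<open>B\<close>; the
    resulting bound on \<open>u\<close> depends on \<open>y\<close> only through
    \<open>p\<close>.\<close>
  then have u2: "u\<^sup>2 \<le> a\<^sup>2 + 2 * p + B\<^sup>2"
    using power_mono[OF assms b0, of 2] by simp
  have "cosh u \<le> cosh a * cosh B + sinh a / a * (sinh B / B) * p"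
  proof (cases "a = 0 \<or> B = 0")
    case True
    then have "p = 0"
      using p by auto
    with u2 True have "u\<^sup>2 \<le> (a + B)\<^sup>2"
      by auto
    then have "u \<le> a + B"
      by (rule power2_le_imp_le) (use a0 B0 in simp)
    then have "cosh u \<le> cosh (a + B)"
      using u0 a0 B0 by (subst cosh_real_nonneg_le_iff) auto
    moreover have "cosh (a + B) = cosh a * cosh B"
      using True by auto
    ultimately show ?thesis
      using \<open>p = 0\<close> by simp
  next
    case False
    with a0 B0 have pos: "0 < a" "0 < B"
      by auto
    \<comment> \<open>\<open>q\<close> plays the role of a cosine, and \<open>t\<close> is the
      weight that makes \<open>a\<^sup>2 + 2 * p + B\<^sup>2\<close> a convex combination of
      \<open>(a - B)\<^sup>2\<close> and \<open>(a + B)\<^sup>2\<close>. Convexity of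
      \<open>cosh (sqrt _)\<close> then bounds \<open>cosh u\<close> by a chord, which is affine in
      \<open>p\<close>.\<close>
    define q where "q = p / (a * B)"
    define t where "t = (1 + q) / 2"
    have pq: "p = q * (a * B)"
      using pos by (simp add: q_def)
    have q: "\<bar>q\<bar> \<le> 1"
      using p pos by (simp add: q_def abs_mult)
    have t: "0 \<le> t" "t \<le> 1"
      using q by (auto simp: t_def)
    have mix: "(1 - t) * (a - B)\<^sup>2 + t * (a + B)\<^sup>2 = a\<^sup>2 + 2 * p + B\<^sup>2"
      unfolding t_def pq by (simp add: power2_eq_square field_simps)
    have "u \<le> sqrt ((1 - t) * (a - B)\<^sup>2 + t * (a + B)\<^sup>2)"
      using u2 unfolding mix by (rule real_le_rsqrt)
    then have "cosh u \<le> cosh (sqrt ((1 - t) * (a - B)\<^sup>2 + t * (a + B)\<^sup>2))"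
      using u0 t by (subst cosh_real_nonneg_le_iff) auto
    also have "\<dots> \<le> (1 - t) * cosh (sqrt ((a - B)\<^sup>2)) + t * cosh (sqrt ((a + B)\<^sup>2))"
      using convex_onD[OF convex_on_cosh_sqrt, of t "(a - B)\<^sup>2" "(a + B)\<^sup>2"] t by simp
    also have "\<dots> = (1 - t) * cosh (a - B) + t * cosh (a + B)"
      by simp
    also have "\<dots> = cosh a * cosh B + q * (sinh a * sinh B)"
      unfolding t_def by (simp add: cosh_add cosh_diff field_simps)
    also have "q * (sinh a * sinh B) = sinh a / a * (sinh B / B) * p"
      using pos by (simp add: pq)
    finally show ?thesis .
  qed
  then show ?thesis
    unfolding a_def p_def u_def .
qed

lemma measurable_L2_set:
  assumes "\<And>i. i \<in> D \<Longrightarrow> f i \<in> borel_measurable M"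
  shows "(\<lambda>x. L2_set (\<lambda>i. f i x) D) \<in> borel_measurable M"
  unfolding L2_set_def
  by (intro measurable_compose[OF _ borel_measurable_sqrt] borel_measurable_sum borel_measurable_power)
    (rule assms)

lemma abs_le_L2_set: "finite D \<Longrightarrow> i \<in> D \<Longrightarrow> \<bar>x i\<bar> \<le> L2_set x D"
  using member_le_L2_set[of D i "\<lambda>i. \<bar>x i\<bar>"] by (simp add: L2_set_def)

lemma borel_measurable_cosh [measurable]: "(cosh :: real \<Rightarrow> real) \<in> borel_measurable borel"
  by (intro borel_measurable_continuous_onI continuous_on_cosh continuous_on_id)

subsection \<open>Concentration of sums of bounded random vectors\<close>

context prob_space
begin

lemma integrable_bounded:
  fixes f :: "'a \<Rightarrow> real"
  assumes "f \<in> borel_measurable M" "\<And>y. y \<in> space M \<Longrightarrow> \<bar>f y\<bar> \<le> B"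
  shows "integrable M f"
  by (rule integrable_const_bound[where B = B]) (use assms in auto)

text \<open>The pointwise bound \<open>cosh_L2_set_add_le\<close> is affine in \<open>G y\<close>,
  and its linear part has expectation 0.\<close>

lemma nn_integral_cosh_L2_set_add_le:
  assumes D: "finite D"
    and [measurable]: "\<And>i. i \<in> D \<Longrightarrow> (\<lambda>y. G y i) \<in> borel_measurable M"
    and B: "\<And>y. y \<in> space M \<Longrightarrow> L2_set (G y) D \<le> B"
    and mean: "\<And>i. i \<in> D \<Longrightarrow> expectation (\<lambda>y. G y i) = 0"
  shows "(\<integral>\<^sup>+y. ennreal (cosh (L2_set (\<lambda>i. a i + G y i) D)) \<partial>M)
    \<le> ennreal (cosh (L2_set a D) * cosh B)"
proof -
  define c where "c = sinh (L2_set a D) / L2_set a D * (sinh B / B)"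
  define f where "f y = cosh (L2_set a D) * cosh B + c * (\<Sum>i\<in>D. a i * G y i)" for y
  have int: "integrable M (\<lambda>y. G y i)" if "i \<in> D" for i
    using that by (intro integrable_bounded[where B = B] order_trans[OF abs_le_L2_set[OF D] B]) auto
  have f: "cosh (L2_set (\<lambda>i. a i + G y i) D) \<le> f y" if "y \<in> space M" for y
    unfolding f_def c_def by (rule cosh_L2_set_add_le[OF B[OF that]])
  have "(\<integral>\<^sup>+y. ennreal (cosh (L2_set (\<lambda>i. a i + G y i) D)) \<partial>M) \<le> (\<integral>\<^sup>+y. ennreal (f y) \<partial>M)"
    by (intro nn_integral_mono ennreal_leI f)
  also have "\<dots> = ennreal (expectation f)"
  proof (rule nn_integral_eq_integral)
    show "integrable M f"
      unfolding f_def by (intro Bochner_Integration.integrable_add integrable_const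
          integrable_mult_right Bochner_Integration.integrable_sum int)
    \<comment> \<open>\<open>f\<close> dominates a \<open>cosh\<close>, so it is nonnegative
      although its linear part may change sign.\<close>
    show "AE y in M. 0 \<le> f y"
      using f cosh_real_nonneg order_trans by (intro AE_I2) blast
  qed
  also have "expectation f = cosh (L2_set a D) * cosh B"
  proof -
    have "expectation f =
        expectation (\<lambda>y. cosh (L2_set a D) * cosh B) + expectation (\<lambda>y. c * (\<Sum>i\<in>D. a i * G y i))"
      unfolding f_def by (intro Bochner_Integration.integral_add integrable_const
          integrable_mult_right Bochner_Integration.integrable_sum int)
    also have "expectation (\<lambda>y. c * (\<Sum>i\<in>D. a i * G y i)) = 0"
      by (simp add: int mean)
    finally show ?thesis
      by (simp add: prob_space)
  qed
  finally show ?thesis .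
qed

lemma nn_integral_cosh_L2_set_sum_le:
  assumes D: "finite D" and J: "finite J"
    and G [measurable]: "\<And>i. i \<in> D \<Longrightarrow> (\<lambda>y. G y i) \<in> borel_measurable M"
    and B: "\<And>y. y \<in> space M \<Longrightarrow> L2_set (G y) D \<le> B"
    and mean: "\<And>i. i \<in> D \<Longrightarrow> expectation (\<lambda>y. G y i) = 0"
  shows "(\<integral>\<^sup>+x. ennreal (cosh (L2_set (\<lambda>i. a i + (\<Sum>k\<in>J. G (x k) i)) D)) \<partial>(\<Pi>\<^sub>M k\<in>J. M))
    \<le> ennreal (cosh (L2_set a D) * cosh B ^ card J)"
  using J
proof (induction J arbitrary: a rule: finite_induct)
  case empty
  interpret product_prob_space "\<lambda>_. M" "{}"
    by unfold_locales
  show ?case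
    by (simp add: P.emeasure_space_1)
next
  case (insert j J)
  interpret P: product_sigma_finite "\<lambda>_. M"
    by unfold_locales
  have G': "(\<lambda>x. G (x k) i) \<in> borel_measurable (PiM K (\<lambda>_. M))" if "i \<in> D" "k \<in> K" for i k K
    using measurable_compose[OF measurable_component_singleton[OF that(2)] G[OF that(1)]] .
  have "(\<integral>\<^sup>+x. ennreal (cosh (L2_set (\<lambda>i. a i + (\<Sum>k\<in>insert j J. G (x k) i)) D)) \<partial>(\<Pi>\<^sub>M k\<in>insert j J. M))
    = (\<integral>\<^sup>+y. (\<integral>\<^sup>+x. ennreal (cosh (L2_set (\<lambda>i. a i + (\<Sum>k\<in>insert j J. G ((x(j := y)) k) i)) D))
         \<partial>(\<Pi>\<^sub>M k\<in>J. M)) \<partial>M)"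
  proof (rule P.product_nn_integral_insert_rev[OF insert.hyps(1,2)])
    have "(\<lambda>x. L2_set (\<lambda>i. a i + (\<Sum>k\<in>insert j J. G (x k) i)) D) \<in> borel_measurable (\<Pi>\<^sub>M k\<in>insert j J. M)"
      by (intro measurable_L2_set borel_measurable_add borel_measurable_sum G') auto
    then show "(\<lambda>x. ennreal (cosh (L2_set (\<lambda>i. a i + (\<Sum>k\<in>insert j J. G (x k) i)) D)))
        \<in> borel_measurable (\<Pi>\<^sub>M k\<in>insert j J. M)"
      by measurable
  qed
  also have "\<dots> = (\<integral>\<^sup>+y. (\<integral>\<^sup>+x. ennreal (cosh (L2_set (\<lambda>i. (a i + G y i) + (\<Sum>k\<in>J. G (x k) i)) D))
         \<partial>(\<Pi>\<^sub>M k\<in>J. M)) \<partial>M)"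
  proof -
    have eq: "a i + (\<Sum>k\<in>insert j J. G ((x(j := y)) k) i) = (a i + G y i) + (\<Sum>k\<in>J. G (x k) i)" for i x y
    proof -
      have "(\<Sum>k\<in>J. G ((x(j := y)) k) i) = (\<Sum>k\<in>J. G (x k) i)"
        using insert.hyps by (intro sum.cong) auto
      then show ?thesis
        using insert.hyps by simp
    qed
    show ?thesis
      by (simp only: eq)
  qed
  also have "\<dots> \<le> (\<integral>\<^sup>+y. ennreal (cosh (L2_set (\<lambda>i. a i + G y i) D)) * ennreal (cosh B ^ card J) \<partial>M)"
    by (intro nn_integral_mono order_trans[OF insert.IH]) (simp add: ennreal_mult)
  also have "\<dots> = (\<integral>\<^sup>+y. ennreal (cosh (L2_set (\<lambda>i. a i + G y i) D)) \<partial>M) * ennreal (cosh B ^ card J)"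
  proof (rule nn_integral_multc)
    have "(\<lambda>y. L2_set (\<lambda>i. a i + G y i) D) \<in> borel_measurable M"
      by (intro measurable_L2_set borel_measurable_add G) auto
    then show "(\<lambda>y. ennreal (cosh (L2_set (\<lambda>i. a i + G y i) D))) \<in> borel_measurable M"
      by measurable
  qed
  also have "\<dots> \<le> ennreal (cosh (L2_set a D) * cosh B) * ennreal (cosh B ^ card J)"
    by (intro mult_right_mono nn_integral_cosh_L2_set_add_le D G B mean) auto
  also have "\<dots> = ennreal (cosh (L2_set a D) * cosh B ^ card (insert j J))"
    using insert.hyps by (simp add: ennreal_mult[symmetric] mult_ac)
  finally show ?case .
qed

text \<open>Markov's inequality is applied to \<open>cosh (r * ?S x)\<close>, whose expectation the
  previous lemma bounds without any dependence on the dimension. The factor 2 comes from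
  \<open>exp x \<le> 2 * cosh x\<close>. That \<open>m\<close> may exceed \<open>card J\<close>
  later permits a sum with one index removed, even an empty one.\<close>

theorem Hoeffding_L2_set:
  assumes D: "finite D" and J: "finite J"
    and G [measurable]: "\<And>i. i \<in> D \<Longrightarrow> (\<lambda>y. G y i) \<in> borel_measurable M"
    and B: "\<And>y. y \<in> space M \<Longrightarrow> L2_set (G y) D \<le> B"
    and mean: "\<And>i. i \<in> D \<Longrightarrow> expectation (\<lambda>y. G y i) = 0"
    and m: "real (card J) \<le> m" "0 < m" and B0: "0 < B" and t: "0 \<le> t"
  shows "emeasure (\<Pi>\<^sub>M k\<in>J. M) {x \<in> space (\<Pi>\<^sub>M k\<in>J. M). t \<le> L2_set (\<lambda>i. \<Sum>k\<in>J. G (x k) i) D}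
    \<le> ennreal (2 * exp (- t\<^sup>2 / (2 * m * B\<^sup>2)))"
proof -
  \<comment> \<open>This \<open>r\<close> minimises the final exponent
    \<open>- r * t + m * (r * B)\<^sup>2 / 2\<close>.\<close>
  define r where "r = t / (m * B\<^sup>2)"
  have r: "0 \<le> r"
    using assms by (simp add: r_def)
  let ?P = "\<Pi>\<^sub>M k\<in>J. M"
  let ?S = "\<lambda>x. L2_set (\<lambda>i. \<Sum>k\<in>J. G (x k) i) D"
  have G': "(\<lambda>x. G (x k) i) \<in> borel_measurable ?P" if "i \<in> D" "k \<in> J" for i k
    using measurable_compose[OF measurable_component_singleton[OF that(2)] G[OF that(1)]] .
  have [measurable]: "?S \<in> borel_measurable ?P"
    by (intro measurable_L2_set borel_measurable_sum G') auto
  have "(\<integral>\<^sup>+x. ennreal (cosh (r * ?S x)) \<partial>?P) =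
      (\<integral>\<^sup>+x. ennreal (cosh (L2_set (\<lambda>i. (\<lambda>_. 0) i + (\<Sum>k\<in>J. r * G (x k) i)) D)) \<partial>?P)"
    using r by (simp add: L2_set_right_distrib sum_distrib_left)
  also have "\<dots> \<le> ennreal (cosh (L2_set (\<lambda>_. 0) D) * cosh (r * B) ^ card J)"
  proof (rule nn_integral_cosh_L2_set_sum_le[OF D J])
    show "L2_set (\<lambda>i. r * G y i) D \<le> r * B" if "y \<in> space M" for y
      using mult_left_mono[OF B[OF that] r] r by (simp add: L2_set_right_distrib)
  qed (use mean in auto)
  also have "\<dots> \<le> ennreal (exp (m * (r * B)\<^sup>2 / 2))"
  proof (rule ennreal_leI)
    have "cosh (r * B) ^ card J \<le> exp ((r * B)\<^sup>2 / 2) ^ card J"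
      by (intro power_mono cosh_le_exp_square_half) auto
    also have "\<dots> = exp (real (card J) * ((r * B)\<^sup>2 / 2))"
      by (rule exp_of_nat_mult[symmetric])
    also have "\<dots> \<le> exp (m * ((r * B)\<^sup>2 / 2))"
      using m by (subst exp_le_cancel_iff) (intro mult_right_mono, auto)
    finally show "cosh (L2_set (\<lambda>_. 0) D) * cosh (r * B) ^ card J \<le> exp (m * (r * B)\<^sup>2 / 2)"
      by (simp add: L2_set_def)
  qed
  finally have mgf: "(\<integral>\<^sup>+x. ennreal (cosh (r * ?S x)) \<partial>?P) \<le> ennreal (exp (m * (r * B)\<^sup>2 / 2))" .
  have "emeasure ?P {x \<in> space ?P. t \<le> ?S x} = (\<integral>\<^sup>+x. indicator {x \<in> space ?P. t \<le> ?S x} x \<partial>?P)"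
    by simp
  also have "\<dots> \<le> (\<integral>\<^sup>+x. ennreal (2 * exp (- r * t)) * ennreal (cosh (r * ?S x)) \<partial>?P)"
  proof (intro nn_integral_mono)
    fix x
    have "1 \<le> 2 * exp (- r * t) * cosh (r * ?S x)" if "t \<le> ?S x"
    proof -
      have "exp (r * t) \<le> exp (r * ?S x)"
        using that r by (simp add: mult_left_mono)
      also have "\<dots> \<le> 2 * cosh (r * ?S x)"
        by (simp add: cosh_def)
      finally have "exp (- r * t) * exp (r * t) \<le> exp (- r * t) * (2 * cosh (r * ?S x))"
        by (intro mult_left_mono) auto
      then show ?thesis
        by (simp add: mult_ac flip: exp_add)
    qed
    then show "indicator {x \<in> space ?P. t \<le> ?S x} x \<le> ennreal (2 * exp (- r * t)) * ennreal (cosh (r * ?S x))"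
      by (auto simp: indicator_def simp flip: ennreal_mult)
  qed
  also have "\<dots> = ennreal (2 * exp (- r * t)) * (\<integral>\<^sup>+x. ennreal (cosh (r * ?S x)) \<partial>?P)"
    by (rule nn_integral_cmult) measurable
  also have "\<dots> \<le> ennreal (2 * exp (- r * t)) * ennreal (exp (m * (r * B)\<^sup>2 / 2))"
    by (intro mult_left_mono mgf) simp
  also have "\<dots> = ennreal (2 * (exp (- r * t) * exp (m * (r * B)\<^sup>2 / 2)))"
    by (simp add: mult.assoc flip: ennreal_mult)
  also have "exp (- r * t) * exp (m * (r * B)\<^sup>2 / 2) = exp (- r * t + m * (r * B)\<^sup>2 / 2)"
    by (rule exp_add[symmetric])
  also have "- r * t + m * (r * B)\<^sup>2 / 2 = - t\<^sup>2 / (2 * m * B\<^sup>2)"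
    using m B0 by (simp add: r_def field_simps power2_eq_square)
  finally show ?thesis .
qed

end

subsection \<open>Softmax averages of an isotropic random vector\<close>

text \<open>Both signs follow from \<open>1 + u \<le> exp u\<close>, taken at \<open>u = - x\<close>
  for nonnegative \<open>x\<close> and at \<open>u = x\<close> otherwise. The constant 3 is an upper
  bound for \<open>exp 1\<close>.\<close>

lemma abs_exp_minus_1_le:
  fixes x :: real
  assumes "\<bar>x\<bar> \<le> 1"
  shows "\<bar>exp x - 1\<bar> \<le> 3 * \<bar>x\<bar>"
proof (cases "0 \<le> x")
  case True
  have "exp x * (1 - x) \<le> exp x * exp (- x)"
    using exp_ge_add_one_self[of "- x"] by (intro mult_left_mono) auto
  then have "exp x - 1 \<le> exp x * x"
    by (simp add: exp_minus algebra_simps)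
  also have "exp x \<le> 3"
    using assms exp_le by (intro order_trans[of "exp x" "exp 1" 3]) auto
  then have "exp x * x \<le> 3 * x"
    using True by (intro mult_right_mono) auto
  finally show ?thesis
    using True by simp
next
  case False
  then have "exp x \<le> 1"
    by simp
  with False exp_ge_add_one_self[of x] show ?thesis
    by linarith
qed

lemma L2_set_mult_left: "L2_set (\<lambda>i. c * f i) D = \<bar>c\<bar> * L2_set f D"
  by (simp add: L2_set_right_distrib) (simp add: L2_set_def power_mult_distrib)

text \<open>These assumptions collect all that the concentration argument uses of the uniform law on
  the sphere. The norm is only bounded by 1, not equal to 1, so that truncated coordinates qualify;
  \<open>\<sigma>\<close> is the common variance of the coordinates.\<close>

locale isotropic_unit_ball = prob_space M for M :: "'a measure" +
  fixes D :: "'i set" and X :: "'a \<Rightarrow> 'i \<Rightarrow> real" and \<sigma> :: real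
  assumes finite_D: "finite D" and D_nonempty: "D \<noteq> {}"
    and measurable_X [measurable]: "\<And>i. i \<in> D \<Longrightarrow> (\<lambda>y. X y i) \<in> borel_measurable M"
    and norm_X: "\<And>y. y \<in> space M \<Longrightarrow> L2_set (X y) D \<le> 1"
    and mean_X: "\<And>i. i \<in> D \<Longrightarrow> expectation (\<lambda>y. X y i) = 0"
    and cov_X: "\<And>i j. i \<in> D \<Longrightarrow> j \<in> D \<Longrightarrow>
      expectation (\<lambda>y. X y i * X y j) = (if i = j then \<sigma> else 0)"
begin

lemma measurable_inner [measurable]: "(\<lambda>y. \<Sum>i\<in>D. v i * X y i) \<in> borel_measurable M"
  by (intro borel_measurable_sum borel_measurable_times borel_measurable_const measurable_X)

lemma abs_inner_le: "y \<in> space M \<Longrightarrow> \<bar>\<Sum>i\<in>D. v i * X y i\<bar> \<le> L2_set v D"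
  using abs_sum_mult_le_L2_set[of v "X y" D] mult_left_mono[OF norm_X, of y "L2_set v D"] by simp

lemma abs_X_le: "y \<in> space M \<Longrightarrow> i \<in> D \<Longrightarrow> \<bar>X y i\<bar> \<le> 1"
  using abs_le_L2_set[OF finite_D, of i "X y"] norm_X[of y] by linarith

lemma integrable_inner_square: "integrable M (\<lambda>y. (\<Sum>i\<in>D. v i * X y i)\<^sup>2)"
proof (rule integrable_bounded)
  show "\<bar>(\<Sum>i\<in>D. v i * X y i)\<^sup>2\<bar> \<le> (L2_set v D)\<^sup>2" if "y \<in> space M" for y
    using power_mono[OF abs_inner_le[OF that, of v], of 2] by simp
qed measurable

lemma expectation_inner_square: "expectation (\<lambda>y. (\<Sum>i\<in>D. v i * X y i)\<^sup>2) = \<sigma> * (L2_set v D)\<^sup>2"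
proof -
  have int: "integrable M (\<lambda>y. X y i * X y j)" if "i \<in> D" "j \<in> D" for i j
  proof (rule integrable_bounded)
    show "\<bar>X y i * X y j\<bar> \<le> 1" if "y \<in> space M" for y
      using abs_X_le[OF that \<open>i \<in> D\<close>] abs_X_le[OF that \<open>j \<in> D\<close>] by (simp add: abs_mult mult_le_one)
  qed (use that in measurable)
  have "expectation (\<lambda>y. (\<Sum>i\<in>D. v i * X y i)\<^sup>2) =
      expectation (\<lambda>y. \<Sum>i\<in>D. \<Sum>j\<in>D. (v i * v j) * (X y i * X y j))"
    by (simp add: power2_eq_square sum_product mult_ac)
  also have "\<dots> = (\<Sum>i\<in>D. \<Sum>j\<in>D. (v i * v j) * expectation (\<lambda>y. X y i * X y j))"
    using int by simp
  also have "\<dots> = (\<Sum>i\<in>D. \<Sum>j\<in>D. if i = j then \<sigma> * (v i)\<^sup>2 else 0)"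
    by (intro sum.cong) (auto simp: cov_X power2_eq_square)
  also have "\<dots> = \<sigma> * (L2_set v D)\<^sup>2"
    by (simp add: finite_D L2_set_power2 sum_distrib_left)
  finally show ?thesis .
qed

text \<open>The left-hand side is the trace of the covariance matrix, that is, the expectation of
  \<open>\<parallel>X\<parallel>\<^sup>2\<close>. This is the source of the decay
  \<open>1 / d\<close>.\<close>

lemma card_mult_variance_le_1: "real (card D) * \<sigma> \<le> 1"
proof -
  have int: "integrable M (\<lambda>y. (X y i)\<^sup>2)" if "i \<in> D" for i
  proof (rule integrable_bounded)
    show "\<bar>(X y i)\<^sup>2\<bar> \<le> 1" if "y \<in> space M" for y
      using abs_X_le[OF that \<open>i \<in> D\<close>] by (simp add: abs_square_le_1)
  qed (use that in measurable)
  have "real (card D) * \<sigma> = (\<Sum>i\<in>D. expectation (\<lambda>y. (X y i)\<^sup>2))"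
    by (simp add: power2_eq_square cov_X)
  also have "\<dots> = expectation (\<lambda>y. \<Sum>i\<in>D. (X y i)\<^sup>2)"
    using int by simp
  also have "\<dots> \<le> expectation (\<lambda>y. 1)"
  proof (rule integral_mono)
    show "(\<Sum>i\<in>D. (X y i)\<^sup>2) \<le> 1" if "y \<in> space M" for y
      using power_mono[OF norm_X[OF that], of 2] by (simp add: L2_set_power2)
  qed (use int in auto)
  finally show ?thesis
    by (simp add: prob_space)
qed

text \<open>With \<open>w\<close> the transformed query, this is one summand of the softmax
  numerator.\<close>

definition tilt :: "('i \<Rightarrow> real) \<Rightarrow> 'a \<Rightarrow> 'i \<Rightarrow> real" where
  "tilt w y i = exp (\<Sum>l\<in>D. w l * X y l) * X y i"

definition tilt_mean :: "('i \<Rightarrow> real) \<Rightarrow> 'i \<Rightarrow> real" where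
  "tilt_mean w i = expectation (\<lambda>y. tilt w y i)"

lemma measurable_tilt [measurable]: "i \<in> D \<Longrightarrow> (\<lambda>y. tilt w y i) \<in> borel_measurable M"
  unfolding tilt_def by measurable

lemma norm_tilt:
  assumes "L2_set w D \<le> 1" "y \<in> space M"
  shows "L2_set (tilt w y) D \<le> 3"
proof -
  have "L2_set (tilt w y) D = exp (\<Sum>l\<in>D. w l * X y l) * L2_set (X y) D"
    by (simp add: tilt_def[abs_def] L2_set_mult_left)
  also have "\<dots> \<le> exp 1 * 1"
    using abs_inner_le[OF assms(2), of w] assms norm_X by (intro mult_mono) auto
  finally show ?thesis
    using exp_le by simp
qed

lemma integrable_tilt:
  assumes "L2_set w D \<le> 1" "i \<in> D"
  shows "integrable M (\<lambda>y. tilt w y i)"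
  using assms by (intro integrable_bounded[where B = 3] order_trans[OF abs_le_L2_set[OF finite_D] norm_tilt]) auto

lemma variance_nonneg: "0 \<le> \<sigma>"
proof -
  obtain i where "i \<in> D"
    using D_nonempty by auto
  then have "\<sigma> = expectation (\<lambda>y. X y i * X y i)"
    by (simp add: cov_X)
  then show ?thesis
    by simp
qed

text \<open>Since \<open>X\<close> is centred, only \<open>exp \<langle>w, X\<rangle> - 1 = O(\<bar>\<langle>w, X\<rangle>\<bar>)\<close> contributes to the mean,
  and isotropy bounds the resulting product of two linear forms.\<close>

lemma norm_tilt_mean:
  assumes w: "L2_set w D \<le> 1"
  shows "L2_set (tilt_mean w) D \<le> 3 * \<sigma>"
proof (cases "L2_set (tilt_mean w) D = 0")
  case True
  with variance_nonneg show ?thesis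
    by simp
next
  case False
  define N where "N = L2_set (tilt_mean w) D"
  have N: "0 < N"
    using False by (simp add: N_def order_less_le)
  let ?w = "\<lambda>y. \<Sum>i\<in>D. w i * X y i"
  let ?m = "\<lambda>y. \<Sum>i\<in>D. tilt_mean w i * X y i"
  have int_m: "integrable M ?m"
    by (rule integrable_bounded[OF _ abs_inner_le]) measurable
  have int_em: "integrable M (\<lambda>y. exp (?w y) * ?m y)"
  proof (rule integrable_bounded)
    show "\<bar>exp (?w y) * ?m y\<bar> \<le> exp 1 * N" if "y \<in> space M" for y
      unfolding abs_mult N_def using abs_inner_le[OF that, of w] abs_inner_le[OF that, of "tilt_mean w"] w
      by (intro mult_mono) auto
  qed measurable
  have "expectation ?m = (\<Sum>i\<in>D. tilt_mean w i * expectation (\<lambda>y. X y i))"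
    by (subst Bochner_Integration.integral_sum)
      (auto intro!: integrable_mult_right integrable_bounded[OF measurable_X abs_X_le])
  then have m0: "expectation ?m = 0"
    by (simp add: mean_X)
  \<comment> \<open>Pairing the tilted mean with itself turns its norm into the expectation of a
    scalar random variable.\<close>
  have "N\<^sup>2 = (\<Sum>i\<in>D. tilt_mean w i * expectation (\<lambda>y. tilt w y i))"
    unfolding N_def L2_set_power2 by (simp add: power2_eq_square flip: tilt_mean_def)
  also have "\<dots> = expectation (\<lambda>y. \<Sum>i\<in>D. tilt_mean w i * tilt w y i)"
    using integrable_tilt[OF w] by simp
  also have "\<dots> = expectation (\<lambda>y. exp (?w y) * ?m y)"
    by (simp add: tilt_def sum_distrib_left mult_ac)
  also have "\<dots> = expectation (\<lambda>y. exp (?w y) * ?m y - ?m y)"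
    using int_em int_m m0 by simp
  also have "\<dots> \<le> expectation (\<lambda>y. 3 / 2 * (N * (?w y)\<^sup>2 + (?m y)\<^sup>2 / N))"
  proof (rule integral_mono)
    fix y
    assume y: "y \<in> space M"
    have "exp (?w y) * ?m y - ?m y \<le> \<bar>exp (?w y) - 1\<bar> * \<bar>?m y\<bar>"
      by (simp add: left_diff_distrib flip: abs_mult)
    also have "\<dots> \<le> 3 * \<bar>?w y\<bar> * \<bar>?m y\<bar>"
      using abs_inner_le[OF y, of w] w by (intro mult_right_mono abs_exp_minus_1_le) auto
    also have "\<dots> = 3 / 2 * (2 * \<bar>?w y\<bar> * \<bar>?m y\<bar>)"
      by simp
    \<comment> \<open>The arithmetic-geometric mean inequality is weighted by \<open>N\<close> so
      that both terms have expectation at most \<open>N * \<sigma>\<close>.\<close>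
    also have "2 * \<bar>?w y\<bar> * \<bar>?m y\<bar> \<le> N * (?w y)\<^sup>2 + (?m y)\<^sup>2 / N"
    proof -
      have "0 \<le> (N * \<bar>?w y\<bar> - \<bar>?m y\<bar>)\<^sup>2 / N"
        using N by simp
      also have "\<dots> = N * (?w y)\<^sup>2 + (?m y)\<^sup>2 / N - 2 * \<bar>?w y\<bar> * \<bar>?m y\<bar>"
        using N by (simp add: power2_eq_square field_simps)
      finally show ?thesis
        by simp
    qed
    finally show "exp (?w y) * ?m y - ?m y \<le> 3 / 2 * (N * (?w y)\<^sup>2 + (?m y)\<^sup>2 / N)"
      by simp
  qed (use int_em int_m in \<open>auto intro!: integrable_inner_square integrable_mult_right integrable_divide Bochner_Integration.integrable_add Bochner_Integration.integrable_diff\<close>)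
  also have "\<dots> = 3 / 2 * (N * (\<sigma> * (L2_set w D)\<^sup>2) + \<sigma> * N\<^sup>2 / N)"
    by (simp add: integrable_inner_square expectation_inner_square flip: N_def)
  finally have main: "N\<^sup>2 \<le> 3 / 2 * (N * (\<sigma> * (L2_set w D)\<^sup>2) + \<sigma> * N\<^sup>2 / N)" .
  have "\<sigma> * (L2_set w D)\<^sup>2 \<le> \<sigma> * 1"
    using w variance_nonneg by (intro mult_left_mono power_le_one) auto
  then have le: "N * (\<sigma> * (L2_set w D)\<^sup>2) \<le> N * \<sigma>"
    using N by simp
  have eq: "\<sigma> * N\<^sup>2 / N = N * \<sigma>"
    using N by (simp add: power2_eq_square)
  have "N\<^sup>2 \<le> N * (3 * \<sigma>)"
    using main[unfolded eq] le by (simp add: algebra_simps)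
  then have "N * N \<le> N * (3 * \<sigma>)"
    by (simp add: power2_eq_square)
  then show ?thesis
    using N by (simp add: N_def)
qed

text \<open>Centring by \<open>tilt_mean\<close> leaves vectors of norm at most
  \<open>3 + 3 * \<sigma> \<le> 6\<close>, to which the Hoeffding bound applies; 72 is
  \<open>2 * 6\<^sup>2\<close>. By \<open>norm_tilt_mean\<close> the removed means add up to at most
  \<open>3 * m * \<sigma>\<close>.\<close>

lemma tilt_sum_tail:
  assumes w: "L2_set w D \<le> 1" and J: "finite J" "real (card J) \<le> m" "0 < m" and t: "0 \<le> t"
  shows "emeasure (\<Pi>\<^sub>M k\<in>J. M)
      {x \<in> space (\<Pi>\<^sub>M k\<in>J. M). t + 3 * m * \<sigma> \<le> L2_set (\<lambda>i. \<Sum>k\<in>J. tilt w (x k) i) D}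
    \<le> ennreal (2 * exp (- t\<^sup>2 / (72 * m)))"
proof -
  let ?P = "\<Pi>\<^sub>M k\<in>J. M"
  define G where "G y i = tilt w y i - tilt_mean w i" for y i
  have G_meas: "(\<lambda>y. G y i) \<in> borel_measurable M" if "i \<in> D" for i
    unfolding G_def using that by measurable
  have G_comp: "(\<lambda>x. G (x k) i) \<in> borel_measurable ?P" if "i \<in> D" "k \<in> J" for i k
    using measurable_compose[OF measurable_component_singleton[OF that(2)] G_meas[OF that(1)]] .
  have "\<sigma> \<le> 1"
  proof -
    have "1 \<le> real (card D)"
      using finite_D D_nonempty by (simp add: Suc_le_eq card_gt_0_iff)
    then have "1 * \<sigma> \<le> real (card D) * \<sigma>"
      using variance_nonneg by (rule mult_right_mono)
    with card_mult_variance_le_1 show ?thesis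
      by linarith
  qed
  have G_bound: "L2_set (G y) D \<le> 6" if "y \<in> space M" for y
  proof -
    have "L2_set (G y) D = L2_set (\<lambda>i. tilt w y i + (- 1) * tilt_mean w i) D"
      by (simp add: G_def[abs_def])
    also have "\<dots> \<le> L2_set (tilt w y) D + L2_set (\<lambda>i. (- 1) * tilt_mean w i) D"
      by (rule L2_set_triangle_ineq)
    also have "\<dots> \<le> 3 + 3 * \<sigma>"
      unfolding L2_set_mult_left using norm_tilt[OF w that] norm_tilt_mean[OF w] by simp
    finally show ?thesis
      using \<open>\<sigma> \<le> 1\<close> by simp
  qed
  have G_mean: "expectation (\<lambda>y. G y i) = 0" if "i \<in> D" for i
    unfolding G_def using integrable_tilt[OF w that] by (simp add: tilt_mean_def prob_space)
  have shift: "L2_set (\<lambda>i. \<Sum>k\<in>J. tilt w (x k) i) D \<le> L2_set (\<lambda>i. \<Sum>k\<in>J. G (x k) i) D + 3 * m * \<sigma>" for x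
  proof -
    have "L2_set (\<lambda>i. \<Sum>k\<in>J. tilt w (x k) i) D =
        L2_set (\<lambda>i. (\<Sum>k\<in>J. G (x k) i) + real (card J) * tilt_mean w i) D"
      by (simp add: G_def sum_subtractf)
    also have "\<dots> \<le> L2_set (\<lambda>i. \<Sum>k\<in>J. G (x k) i) D + L2_set (\<lambda>i. real (card J) * tilt_mean w i) D"
      by (rule L2_set_triangle_ineq)
    also have "L2_set (\<lambda>i. real (card J) * tilt_mean w i) D \<le> m * (3 * \<sigma>)"
      unfolding L2_set_mult_left using J norm_tilt_mean[OF w] by (intro mult_mono) auto
    finally show ?thesis
      by (simp add: mult_ac)
  qed
  have "emeasure ?P {x \<in> space ?P. t + 3 * m * \<sigma> \<le> L2_set (\<lambda>i. \<Sum>k\<in>J. tilt w (x k) i) D}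
      \<le> emeasure ?P {x \<in> space ?P. t \<le> L2_set (\<lambda>i. \<Sum>k\<in>J. G (x k) i) D}"
  proof (rule emeasure_mono)
    show "{x \<in> space ?P. t + 3 * m * \<sigma> \<le> L2_set (\<lambda>i. \<Sum>k\<in>J. tilt w (x k) i) D}
        \<subseteq> {x \<in> space ?P. t \<le> L2_set (\<lambda>i. \<Sum>k\<in>J. G (x k) i) D}"
      by (auto dest: order_trans[OF _ shift])
    have [measurable]: "(\<lambda>x. L2_set (\<lambda>i. \<Sum>k\<in>J. G (x k) i) D) \<in> borel_measurable ?P"
      by (intro measurable_L2_set borel_measurable_sum G_comp)
    show "{x \<in> space ?P. t \<le> L2_set (\<lambda>i. \<Sum>k\<in>J. G (x k) i) D} \<in> sets ?P"
      by measurable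
  qed
  also have "\<dots> \<le> ennreal (2 * exp (- t\<^sup>2 / (2 * m * 6\<^sup>2)))"
    by (rule Hoeffding_L2_set[OF finite_D J(1) G_meas G_bound G_mean J(2,3) _ t]) auto
  finally show ?thesis
    by (simp add: mult_ac)
qed

lemma measurable_tilt_component:
  assumes W: "\<And>i. i \<in> D \<Longrightarrow> (\<lambda>y. W y i) \<in> borel_measurable M"
    and ij: "i \<in> D" "j \<in> I" "k \<in> I"
  shows "(\<lambda>x. tilt (W (x j)) (x k) i) \<in> borel_measurable (\<Pi>\<^sub>M k\<in>I. M)"
proof -
  have "(\<lambda>x. W (x j) l) \<in> borel_measurable (\<Pi>\<^sub>M k\<in>I. M)" if "l \<in> D" for l
    using measurable_compose[OF measurable_component_singleton[OF ij(2)] W[OF that]] .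
  moreover have "(\<lambda>x. X (x k) l) \<in> borel_measurable (\<Pi>\<^sub>M k\<in>I. M)" if "l \<in> D" for l
    using measurable_compose[OF measurable_component_singleton[OF ij(3)] measurable_X[OF that]] .
  ultimately show ?thesis
    unfolding tilt_def using ij
    by (intro borel_measurable_times borel_measurable_sum measurable_compose[OF _ borel_measurable_exp])
qed

lemma self_tilt_sum_tail:
  assumes W: "\<And>i. i \<in> D \<Longrightarrow> (\<lambda>y. W y i) \<in> borel_measurable M"
    and W_le: "\<And>y. y \<in> space M \<Longrightarrow> L2_set (W y) D \<le> 1"
    and I: "finite I" "j \<in> I" "real (card I) \<le> m" and t: "0 \<le> t"
  shows "emeasure (\<Pi>\<^sub>M k\<in>I. M)
      {x \<in> space (\<Pi>\<^sub>M k\<in>I. M).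
        t + 3 * m * \<sigma> \<le> L2_set (\<lambda>i. \<Sum>k\<in>I - {j}. tilt (W (x j)) (x k) i) D}
    \<le> ennreal (2 * exp (- t\<^sup>2 / (72 * m)))"
    (is "emeasure _ ?E \<le> ennreal ?p")
proof -
  interpret P: product_sigma_finite "\<lambda>_. M"
    by unfold_locales
  define J where "J = I - {j}"
  have IJ: "I = insert j J" "finite J" "j \<notin> J"
    using I by (auto simp: J_def)
  have "card J \<le> card I"
    using I by (auto simp: J_def intro: card_mono)
  then have J: "real (card J) \<le> m"
    using I by linarith
  have m: "0 < m"
    using I card_gt_0_iff[of I] by (intro less_le_trans[OF _ I(3)]) auto
  have [measurable]: "(\<lambda>x. L2_set (\<lambda>i. \<Sum>k\<in>I - {j}. tilt (W (x j)) (x k) i) D) \<in> borel_measurable (\<Pi>\<^sub>M k\<in>I. M)"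
    using I by (intro measurable_L2_set borel_measurable_sum measurable_tilt_component W) auto
  have E: "?E \<in> sets (\<Pi>\<^sub>M k\<in>I. M)"
    by measurable
  have "emeasure (\<Pi>\<^sub>M k\<in>I. M) ?E = (\<integral>\<^sup>+x. indicator ?E x \<partial>(\<Pi>\<^sub>M k\<in>insert j J. M))"
    using E by (simp add: IJ(1))
  also have "\<dots> = (\<integral>\<^sup>+y. (\<integral>\<^sup>+x. indicator ?E (x(j := y)) \<partial>(\<Pi>\<^sub>M k\<in>J. M)) \<partial>M)"
    using E by (intro P.product_nn_integral_insert_rev IJ borel_measurable_indicator) (simp add: IJ(1))
  also have "\<dots> \<le> (\<integral>\<^sup>+y. ennreal ?p \<partial>M)"
  proof (rule nn_integral_mono)
    fix y
    assume y: "y \<in> space M"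
    let ?F = "{x \<in> space (\<Pi>\<^sub>M k\<in>J. M). t + 3 * m * \<sigma> \<le> L2_set (\<lambda>i. \<Sum>k\<in>J. tilt (W y) (x k) i) D}"
    have eq: "(\<Sum>k\<in>J. tilt (W y) ((x(j := y)) k) i) = (\<Sum>k\<in>J. tilt (W y) (x k) i)" for x i
      using IJ by (intro sum.cong) auto
    have "(\<integral>\<^sup>+x. indicator ?E (x(j := y)) \<partial>(\<Pi>\<^sub>M k\<in>J. M)) \<le> (\<integral>\<^sup>+x. indicator ?F x \<partial>(\<Pi>\<^sub>M k\<in>J. M))"
    proof (rule nn_integral_mono)
      fix x
      assume x: "x \<in> space (\<Pi>\<^sub>M k\<in>J. M)"
      have "(\<Sum>k\<in>J. tilt (W ((x(j := y)) j)) ((x(j := y)) k) i) = (\<Sum>k\<in>J. tilt (W y) (x k) i)" for i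
        by (simp only: fun_upd_same eq)
      then show "indicator ?E (x(j := y)) \<le> (indicator ?F x :: ennreal)"
        using x unfolding J_def[symmetric] by (auto simp: indicator_def simp del: fun_upd_apply)
    qed
    also have "\<dots> = emeasure (\<Pi>\<^sub>M k\<in>J. M) ?F"
    proof (rule nn_integral_indicator)
      have "(\<lambda>x. tilt (W y) (x k) i) \<in> borel_measurable (\<Pi>\<^sub>M k\<in>J. M)" if "i \<in> D" "k \<in> J" for i k
        using measurable_compose[OF measurable_component_singleton[OF that(2)] measurable_tilt[OF that(1)]] .
      then have [measurable]: "(\<lambda>x. L2_set (\<lambda>i. \<Sum>k\<in>J. tilt (W y) (x k) i) D) \<in> borel_measurable (\<Pi>\<^sub>M k\<in>J. M)"
        by (intro measurable_L2_set borel_measurable_sum)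
      show "?F \<in> sets (\<Pi>\<^sub>M k\<in>J. M)"
        by measurable
    qed
    also have "\<dots> \<le> ennreal ?p"
      by (rule tilt_sum_tail[OF W_le[OF y] IJ(2) J m t])
    finally show "(\<integral>\<^sup>+x. indicator ?E (x(j := y)) \<partial>(\<Pi>\<^sub>M k\<in>J. M)) \<le> ennreal ?p" .
  qed
  also have "\<dots> = ennreal ?p"
    by (simp add: emeasure_space_1)
  finally show ?thesis .
qed

text \<open>Apart from the summand \<open>k = j\<close>, of norm at most 3, the numerator is
  controlled by \<open>self_tilt_sum_tail\<close>, and the denominator is at least
  \<open>n / 3\<close>. Dividing \<open>3 + t + 3 * n * \<sigma>\<close> by \<open>n / 3\<close>
  gives the threshold; the union bound over \<open>j\<close> gives the factor \<open>n\<close> in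
  the probability.\<close>

theorem softmax_average_concentration:
  assumes W: "\<And>i. i \<in> D \<Longrightarrow> (\<lambda>y. W y i) \<in> borel_measurable M"
    and W_le: "\<And>y. y \<in> space M \<Longrightarrow> L2_set (W y) D \<le> 1"
    and I: "finite I" "I \<noteq> {}" and t: "0 \<le> t"
  defines "n \<equiv> real (card I)"
  defines "a \<equiv> \<lambda>x j k. exp (\<Sum>l\<in>D. W (x j) l * X (x k) l)"
  shows "1 - 2 * n * exp (- t\<^sup>2 / (72 * n)) \<le> measure (\<Pi>\<^sub>M k\<in>I. M)
    {x \<in> space (\<Pi>\<^sub>M k\<in>I. M). \<forall>j\<in>I.
      L2_set (\<lambda>i. (\<Sum>k\<in>I. a x j k * X (x k) i) / (\<Sum>k\<in>I. a x j k)) D \<le> 9 / n + 3 * t / n + 9 * \<sigma>}"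
    (is "_ \<le> measure ?P ?good")
proof -
  interpret P: prob_space ?P
    by (rule prob_space_PiM) unfold_locales
  define E where "E j = {x \<in> space ?P.
    t + 3 * n * \<sigma> \<le> L2_set (\<lambda>i. \<Sum>k\<in>I - {j}. tilt (W (x j)) (x k) i) D}" for j
  have n: "0 < n"
    using I by (simp add: n_def card_gt_0_iff)
  have tilt_meas: "(\<lambda>x. tilt (W (x j)) (x k) i) \<in> borel_measurable ?P" if "i \<in> D" "j \<in> I" "k \<in> I" for i j k
    by (rule measurable_tilt_component[OF W that])
  have E_sets: "E j \<in> sets ?P" if "j \<in> I" for j
  proof -
    have [measurable]: "(\<lambda>x. L2_set (\<lambda>i. \<Sum>k\<in>I - {j}. tilt (W (x j)) (x k) i) D) \<in> borel_measurable ?P"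
      using that by (intro measurable_L2_set borel_measurable_sum tilt_meas) auto
    show ?thesis
      unfolding E_def by measurable
  qed
  have E_prob: "measure ?P (E j) \<le> 2 * exp (- t\<^sup>2 / (72 * n))" if "j \<in> I" for j
    using self_tilt_sum_tail[OF W W_le I(1) that, of n t] t
    unfolding E_def P.emeasure_eq_measure by (simp add: n_def)
  have W_meas: "(\<lambda>x. W (x j) l) \<in> borel_measurable ?P" if "l \<in> D" "j \<in> I" for l j
    using measurable_compose[OF measurable_component_singleton[OF that(2)] W[OF that(1)]] .
  have X_meas: "(\<lambda>x. X (x j) l) \<in> borel_measurable ?P" if "l \<in> D" "j \<in> I" for l j
    using measurable_compose[OF measurable_component_singleton[OF that(2)] measurable_X[OF that(1)]] .
  have a_meas: "(\<lambda>x. a x j k) \<in> borel_measurable ?P" if "j \<in> I" "k \<in> I" for j k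
    unfolding a_def using that
    by (intro borel_measurable_times borel_measurable_sum W_meas X_meas measurable_compose[OF _ borel_measurable_exp])
  have good_sets: "?good \<in> sets ?P"
  proof -
    have [measurable]: "(\<lambda>x. L2_set (\<lambda>i. (\<Sum>k\<in>I. a x j k * X (x k) i) / (\<Sum>k\<in>I. a x j k)) D) \<in> borel_measurable ?P"
      if "j \<in> I" for j
      using that by (intro measurable_L2_set borel_measurable_divide borel_measurable_sum
          borel_measurable_times a_meas X_meas) auto
    show ?thesis
      using I(1) by measurable
  qed
  have good: "space ?P - ?good \<subseteq> (\<Union>j\<in>I. E j)"
  proof
    fix x
    assume "x \<in> space ?P - ?good"
    then obtain j where x: "x \<in> space ?P" and j: "j \<in> I"
      and bad: "9 / n + 3 * t / n + 9 * \<sigma> < L2_set (\<lambda>i. (\<Sum>k\<in>I. a x j k * X (x k) i) / (\<Sum>k\<in>I. a x j k)) D"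
      by auto
    have xM: "x k \<in> space M" if "k \<in> I" for k
      using x that by (auto simp: space_PiM)
    define Z where "Z = (\<Sum>k\<in>I. a x j k)"
    have "exp (- 1) \<le> a x j k" if "k \<in> I" for k
      using abs_inner_le[OF xM[OF that], of "W (x j)"] W_le[OF xM[OF j]] by (simp add: a_def)
    then have "n * exp (- 1) \<le> Z"
      unfolding Z_def n_def by (rule sum_bounded_below)
    moreover have "n / 3 \<le> n * exp (- 1)"
      using n exp_le by (simp add: exp_minus field_simps)
    ultimately have Z: "n / 3 \<le> Z" "0 < Z"
      using n by linarith+
    have split: "(\<Sum>k\<in>I. a x j k * X (x k) i) =
        tilt (W (x j)) (x j) i + (\<Sum>k\<in>I - {j}. tilt (W (x j)) (x k) i)" for i
      unfolding a_def by (simp add: sum.remove[OF I(1) j] tilt_def)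
    have "L2_set (\<lambda>i. \<Sum>k\<in>I. a x j k * X (x k) i) D \<le>
        L2_set (tilt (W (x j)) (x j)) D + L2_set (\<lambda>i. \<Sum>k\<in>I - {j}. tilt (W (x j)) (x k) i) D"
      unfolding split by (rule L2_set_triangle_ineq)
    also have "L2_set (tilt (W (x j)) (x j)) D \<le> 3"
      using W_le xM j by (intro norm_tilt) auto
    finally have S: "L2_set (\<lambda>i. \<Sum>k\<in>I. a x j k * X (x k) i) D \<le>
        3 + L2_set (\<lambda>i. \<Sum>k\<in>I - {j}. tilt (W (x j)) (x k) i) D"
      by simp
    \<comment> \<open>Multiplication by \<open>Z \<ge> n / 3\<close> clears the denominator and
      recovers the threshold of \<open>E j\<close>, enlarged by the 3 that the term
      \<open>k = j\<close> may contribute.\<close>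
    have "(n / 3) * (9 / n + 3 * t / n + 9 * \<sigma>) \<le> Z * (9 / n + 3 * t / n + 9 * \<sigma>)"
      using Z t n variance_nonneg by (intro mult_right_mono) auto
    also have "\<dots> < Z * L2_set (\<lambda>i. (\<Sum>k\<in>I. a x j k * X (x k) i) / Z) D"
      using Z bad unfolding Z_def by (intro mult_strict_left_mono)
    also have "\<dots> = L2_set (\<lambda>i. \<Sum>k\<in>I. a x j k * X (x k) i) D"
      using Z by (simp add: L2_set_right_distrib)
    also have "(n / 3) * (9 / n + 3 * t / n + 9 * \<sigma>) = 3 + t + 3 * n * \<sigma>"
      using n by (simp add: field_simps)
    finally have "3 + t + 3 * n * \<sigma> < 3 + L2_set (\<lambda>i. \<Sum>k\<in>I - {j}. tilt (W (x j)) (x k) i) D"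
      using S by linarith
    then show "x \<in> (\<Union>j\<in>I. E j)"
      using x j by (auto simp: E_def intro!: bexI[of _ j])
  qed
  have "1 - measure ?P ?good = measure ?P (space ?P - ?good)"
    by (rule P.prob_compl[OF good_sets, symmetric])
  also have "\<dots> \<le> measure ?P (\<Union>j\<in>I. E j)"
    using E_sets I(1) by (intro P.finite_measure_mono good sets.finite_UN) auto
  also have "\<dots> \<le> (\<Sum>j\<in>I. measure ?P (E j))"
    using E_sets I(1) by (intro P.finite_measure_subadditive_finite) auto
  also have "\<dots> \<le> (\<Sum>j\<in>I. 2 * exp (- t\<^sup>2 / (72 * n)))"
    by (intro sum_mono E_prob)
  also have "\<dots> = 2 * n * exp (- t\<^sup>2 / (72 * n))"
    by (simp add: n_def)
  finally show ?thesis
    by simp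
qed

end

subsection \<open>The uniform distribution on the sphere\<close>

lemma eucl_norm_eq_L2_set: "v \<in> carrier_vec d \<Longrightarrow> eucl_norm v = L2_set (\<lambda>i. v $ i) {..<d}"
  by (simp add: eucl_norm_def L2_set_def scalar_prod_def power2_eq_square lessThan_atLeast0)

lemma space_borel_vec [simp]: "space (borel_vec d) = carrier_vec d"
  by (simp add: borel_vec_def)

lemma measurable_vec_index [measurable]:
  assumes "i < d"
  shows "(\<lambda>v. v $ i) \<in> borel_measurable (borel_vec d)"
proof -
  have "(\<lambda>v. \<lambda>i\<in>{..<d}. v $ i) \<in> borel_vec d \<rightarrow>\<^sub>M (\<Pi>\<^sub>M i\<in>{..<d}. borel :: real measure)"
    unfolding borel_vec_def by (rule measurable_vimage_algebra1) (auto simp: space_PiM)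
  from measurable_compose[OF this measurable_component_singleton[of i]] assms show ?thesis
    by simp
qed

text \<open>\<open>borel_vec d\<close> is generated by the coordinate maps, so measurability into it
  can be checked on coordinates.\<close>

lemma measurable_into_borel_vec:
  assumes "\<And>x. x \<in> space N \<Longrightarrow> g x \<in> carrier_vec d"
    and "\<And>i. i < d \<Longrightarrow> (\<lambda>x. g x $ i) \<in> borel_measurable N"
  shows "g \<in> N \<rightarrow>\<^sub>M borel_vec d"
  unfolding borel_vec_def
proof (rule measurable_vimage_algebra2)
  show "g \<in> space N \<rightarrow> carrier_vec d"
    using assms(1) by auto
  show "(\<lambda>x. \<lambda>i\<in>{..<d}. g x $ i) \<in> N \<rightarrow>\<^sub>M (\<Pi>\<^sub>M i\<in>{..<d}. borel)"
    using assms(2) by (intro measurable_restrict) auto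
qed

lemma measurable_vec [measurable]: "Matrix.vec d \<in> (\<Pi>\<^sub>M i\<in>{..<d}. lborel) \<rightarrow>\<^sub>M borel_vec d"
  by (rule measurable_into_borel_vec)
    (auto intro: measurable_component_singleton[of _ "{..<d}" "\<lambda>_. lborel :: real measure", simplified measurable_lborel2])

lemma measurable_eucl_norm [measurable]: "eucl_norm \<in> borel_measurable (borel_vec d)"
proof -
  have "(\<lambda>v. L2_set (\<lambda>i. v $ i) {..<d}) \<in> borel_measurable (borel_vec d)"
    by (rule measurable_L2_set) simp
  then show ?thesis
    by (rule measurable_cong[THEN iffD1, rotated]) (simp add: eucl_norm_eq_L2_set)
qed

lemma sets_lborel_vec [measurable_cong]: "sets (lborel_vec d) = sets (borel_vec d)"
  by (simp add: lborel_vec_def)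

lemma space_lborel_vec [simp]: "space (lborel_vec d) = carrier_vec d"
  by (simp add: lborel_vec_def)

lemma sets_unif_sphere [measurable_cong]: "sets (unif_sphere d) = sets (borel_vec d)"
  by (simp add: unif_sphere_def)

lemma space_unif_sphere [simp]: "space (unif_sphere d) = carrier_vec d"
  by (simp add: unif_sphere_def)

abbreviation unit_ball_vec :: "nat \<Rightarrow> real vec set" where
  "unit_ball_vec d \<equiv> {x \<in> carrier_vec d. eucl_norm x \<le> 1}"

lemma unit_ball_vec_sets [measurable]: "unit_ball_vec d \<in> sets (borel_vec d)"
proof -
  have "{x \<in> space (borel_vec d). eucl_norm x \<le> 1} \<in> sets (borel_vec d)"
    by measurable
  then show ?thesis
    by simp
qed

text \<open>The ball lies between two cubes, of half-sides \<open>1 / d\<close> and 1. Normalising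
  Lebesgue measure to a probability on the ball requires both claims.\<close>

lemma emeasure_lborel_vec_unit_ball:
  assumes "0 < d"
  shows "emeasure (lborel_vec d) (unit_ball_vec d) \<noteq> 0" "emeasure (lborel_vec d) (unit_ball_vec d) \<noteq> \<infinity>"
proof -
  interpret product_sigma_finite "\<lambda>_. lborel :: real measure"
    by unfold_locales
  let ?P = "\<Pi>\<^sub>M i\<in>{..<d}. lborel :: real measure"
  let ?B = "Matrix.vec d -` unit_ball_vec d \<inter> space ?P"
  have eq: "emeasure (lborel_vec d) (unit_ball_vec d) = emeasure ?P ?B"
    unfolding lborel_vec_def by (rule emeasure_distr[OF measurable_vec unit_ball_vec_sets])
  have box: "emeasure ?P (\<Pi>\<^sub>E i\<in>{..<d}. {- r..r}) = ennreal ((2 * r) ^ d)" if "0 \<le> r" for r :: real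
    using that by (subst emeasure_PiM) (auto simp: ennreal_power)
  have box_sets: "(\<Pi>\<^sub>E i\<in>{..<d}. {- r..r}) \<in> sets ?P" for r :: real
    by (intro sets_PiM_I_finite) auto
  have B_sets: "?B \<in> sets ?P"
    using measurable_sets[OF measurable_vec unit_ball_vec_sets] .
  have norm: "eucl_norm (Matrix.vec d x) = L2_set x {..<d}" for x
    by (subst eucl_norm_eq_L2_set[of _ d]) (auto intro: L2_set_cong)
  \<comment> \<open>The half-side \<open>1 / d\<close> suffices for positivity, because the
    Euclidean norm is at most the sum of the absolute values of the coordinates.\<close>
  have inner: "(\<Pi>\<^sub>E i\<in>{..<d}. {- (1 / real d)..1 / real d}) \<subseteq> ?B"
  proof
    fix x
    assume x: "x \<in> (\<Pi>\<^sub>E i\<in>{..<d}. {- (1 / real d)..1 / real d})"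
    have "L2_set x {..<d} \<le> (\<Sum>i<d. \<bar>x i\<bar>)"
      by (rule L2_set_le_sum_abs)
    also have "\<dots> \<le> (\<Sum>i<d. 1 / real d)"
      using x by (intro sum_mono) (auto simp: PiE_iff abs_le_iff minus_le_iff)
    finally show "x \<in> ?B"
      using x assms norm by (auto simp: space_PiM PiE_iff)
  qed
  have "ennreal ((2 * (1 / real d)) ^ d) \<le> emeasure ?P ?B"
    unfolding box[of "1 / real d", OF divide_nonneg_nonneg[OF zero_le_one of_nat_0_le_iff], symmetric]
    by (rule emeasure_mono[OF inner B_sets])
  moreover have "0 < ennreal ((2 * (1 / real d)) ^ d)"
    using assms by simp
  ultimately show "emeasure (lborel_vec d) (unit_ball_vec d) \<noteq> 0"
    unfolding eq by (metis leD)
  have outer: "?B \<subseteq> (\<Pi>\<^sub>E i\<in>{..<d}. {- 1..1})"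
  proof
    fix x
    assume x: "x \<in> ?B"
    have "x i \<in> {- 1..1}" if "i < d" for i
      using abs_le_L2_set[of "{..<d}" i x] that norm x by auto
    moreover have "x \<in> extensional {..<d}"
      using x by (simp add: space_PiM PiE_iff)
    ultimately show "x \<in> (\<Pi>\<^sub>E i\<in>{..<d}. {- 1..1})"
      unfolding PiE_iff by blast
  qed
  have "emeasure ?P ?B \<le> ennreal ((2 * 1) ^ d)"
    unfolding box[OF zero_le_one, symmetric] by (rule emeasure_mono[OF outer box_sets[of 1]])
  then show "emeasure (lborel_vec d) (unit_ball_vec d) \<noteq> \<infinity>"
    unfolding eq by (auto simp: top_unique)
qed

lemma measurable_normalize [measurable]:
  "(\<lambda>x. (1 / eucl_norm x) \<cdot>\<^sub>v x) \<in> borel_vec d \<rightarrow>\<^sub>M borel_vec d"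
proof (rule measurable_into_borel_vec)
  fix i
  assume i: "i < d"
  have "(\<lambda>x. 1 / eucl_norm x * x $ i) \<in> borel_measurable (borel_vec d)"
    using i by measurable
  then show "(\<lambda>x. ((1 / eucl_norm x) \<cdot>\<^sub>v x) $ i) \<in> borel_measurable (borel_vec d)"
    by (rule measurable_cong[THEN iffD1, rotated]) (use i in auto)
qed auto

lemma prob_space_unif_sphere:
  assumes "0 < d"
  shows "prob_space (unif_sphere d)"
  unfolding unif_sphere_def
proof (rule prob_space.prob_space_distr)
  show "prob_space (uniform_measure (lborel_vec d) (unit_ball_vec d))"
    by (intro prob_space_uniform_measure emeasure_lborel_vec_unit_ball assms)
qed measurable

lemma eucl_norm_smult: "v \<in> carrier_vec d \<Longrightarrow> eucl_norm (c \<cdot>\<^sub>v v) = \<bar>c\<bar> * eucl_norm v"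
  by (subst (1 2) eucl_norm_eq_L2_set[of _ d]) (auto simp flip: L2_set_mult_left intro: L2_set_cong)

subsection \<open>Signed permutations of the coordinates\<close>

text \<open>These maps stand in for the orthogonal group: sign changes and transpositions of
  coordinates already force the mean to vanish and the covariance to be a multiple of the
  identity.\<close>

definition signed_perm :: "nat \<Rightarrow> (nat \<Rightarrow> real) \<Rightarrow> (nat \<Rightarrow> nat) \<Rightarrow> real vec \<Rightarrow> real vec" where
  "signed_perm d s p v = Matrix.vec d (\<lambda>i. s i * v $ p i)"

text \<open>Taking \<open>p\<close> to be its own inverse keeps preimages explicit and still covers
  the identity and the transpositions, from which isotropy is derived.\<close>

locale signed_involution =
  fixes d :: nat and s :: "nat \<Rightarrow> real" and p :: "nat \<Rightarrow> nat"
  assumes s: "s i = 1 \<or> s i = - 1" and p: "i < d \<Longrightarrow> p i < d" and pp: "i < d \<Longrightarrow> p (p i) = i"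
begin

lemma bij_p: "bij_betw p {..<d} {..<d}"
  by (rule bij_betw_byWitness[where f' = p]) (auto simp: p pp)

lemma measurable_signed_perm [measurable]: "signed_perm d s p \<in> borel_vec d \<rightarrow>\<^sub>M borel_vec d"
proof (rule measurable_into_borel_vec)
  fix i
  assume "i < d"
  moreover from this have "(\<lambda>x. s i * x $ p i) \<in> borel_measurable (borel_vec d)"
    using p by measurable
  ultimately show "(\<lambda>x. signed_perm d s p x $ i) \<in> borel_measurable (borel_vec d)"
    by (simp add: signed_perm_def)
qed (simp add: signed_perm_def)

lemma eucl_norm_signed_perm:
  assumes "v \<in> carrier_vec d"
  shows "eucl_norm (signed_perm d s p v) = eucl_norm v"
proof -
  have s2: "(s i)\<^sup>2 = 1" for i
    using s[of i] by auto
  have "(\<Sum>i<d. (v $ p i)\<^sup>2) = (\<Sum>i<d. (v $ i)\<^sup>2)"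
    using sum.reindex_bij_betw[OF bij_p, of "\<lambda>i. (v $ i)\<^sup>2"] .
  moreover have "eucl_norm (signed_perm d s p v) = sqrt (\<Sum>i<d. (v $ p i)\<^sup>2)"
    by (subst eucl_norm_eq_L2_set[of _ d]) (auto simp: signed_perm_def L2_set_def power_mult_distrib s2)
  ultimately show ?thesis
    using assms by (simp add: eucl_norm_eq_L2_set L2_set_def)
qed

lemma emeasure_lborel_sign:
  assumes "A \<in> sets borel"
  shows "emeasure lborel {t. s i * t \<in> A} = emeasure lborel A"
proof -
  consider "s i = 1" | "s i = - 1"
    using s by auto
  then show ?thesis
  proof cases
    case 2
    have "emeasure lborel A = emeasure (distr lborel borel uminus) A"
      by (simp add: lborel_distr_uminus)
    also have "\<dots> = emeasure lborel {t. - t \<in> A}"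
      using assms by (subst emeasure_distr) (auto simp: vimage_def)
    finally show ?thesis
      using 2 by simp
  qed simp
qed

lemma measurable_signed_perm_PiM:
  "(\<lambda>x. \<lambda>i\<in>{..<d}. s i * x (p i)) \<in> (\<Pi>\<^sub>M i\<in>{..<d}. lborel) \<rightarrow>\<^sub>M (\<Pi>\<^sub>M i\<in>{..<d}. lborel :: real measure)"
proof (rule measurable_restrict)
  fix i
  assume "i \<in> {..<d}"
  then have "(\<lambda>x. x (p i)) \<in> (\<Pi>\<^sub>M i\<in>{..<d}. lborel) \<rightarrow>\<^sub>M (lborel :: real measure)"
    using p by (intro measurable_component_singleton) auto
  then show "(\<lambda>x. s i * x (p i)) \<in> (\<Pi>\<^sub>M i\<in>{..<d}. lborel) \<rightarrow>\<^sub>M lborel"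
    by simp
qed

text \<open>A product measure is determined by its values on boxes. The preimage of a box is again a
  box, with its sides permuted and possibly reflected, and Lebesgue measure on the line is invariant
  under reflection.\<close>

lemma distr_PiM_lborel:
  defines "P \<equiv> \<Pi>\<^sub>M i\<in>{..<d}. lborel"
  shows "distr P P (\<lambda>x. \<lambda>i\<in>{..<d}. s i * x (p i)) = P"
proof -
  interpret product_sigma_finite "\<lambda>_. lborel :: real measure"
    by unfold_locales
  let ?T = "\<lambda>x. \<lambda>i\<in>{..<d}. s i * x (p i)"
  note T = measurable_signed_perm_PiM[folded P_def]
  show ?thesis
    unfolding P_def
  proof (rule PiM_eqI)
    fix A :: "nat \<Rightarrow> real set"
    assume A: "\<And>i. i \<in> {..<d} \<Longrightarrow> A i \<in> sets lborel"
    \<comment> \<open>The constraint on \<open>x i\<close> is the one that coordinate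
      \<open>p i\<close> of the image must satisfy, because \<open>p (p i) = i\<close>.\<close>
    let ?A' = "\<lambda>i. {t. s (p i) * t \<in> A (p i)}"
    have A': "?A' i \<in> sets lborel" if "i \<in> {..<d}" for i
    proof -
      have [measurable]: "A (p i) \<in> sets borel"
        using A[of "p i"] p[of i] that by simp
      have "{t \<in> space borel. s (p i) * t \<in> A (p i)} \<in> sets borel"
        by measurable
      then show ?thesis
        by simp
    qed
    have "?T -` Pi\<^sub>E {..<d} A \<inter> space P = Pi\<^sub>E {..<d} ?A'"
    proof (intro equalityI subsetI)
      fix x
      assume x: "x \<in> ?T -` Pi\<^sub>E {..<d} A \<inter> space P"
      have "s (p i) * x i \<in> A (p i)" if "i < d" for i
      proof -
        have "?T x (p i) \<in> A (p i)"
          using x p[OF that] by (auto simp: PiE_iff)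
        then show ?thesis
          using p[OF that] pp[OF that] by simp
      qed
      then show "x \<in> Pi\<^sub>E {..<d} ?A'"
        using x by (auto simp: P_def space_PiM PiE_iff)
    next
      fix x
      assume x: "x \<in> Pi\<^sub>E {..<d} ?A'"
      have "s i * x (p i) \<in> A i" if "i < d" for i
      proof -
        have "x (p i) \<in> ?A' (p i)"
          using x p[OF that] by (auto simp: PiE_iff)
        then show ?thesis
          using pp[OF that] by simp
      qed
      then show "x \<in> ?T -` Pi\<^sub>E {..<d} A \<inter> space P"
        using x by (auto simp: P_def space_PiM PiE_iff)
    qed
    then have "emeasure (distr P P ?T) (Pi\<^sub>E {..<d} A) = emeasure P (Pi\<^sub>E {..<d} ?A')"
      using A T by (subst emeasure_distr) (auto simp: P_def intro!: sets_PiM_I_finite)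
    also have "\<dots> = (\<Prod>i<d. emeasure lborel (?A' i))"
      unfolding P_def using A' by (intro emeasure_PiM) auto
    also have "\<dots> = (\<Prod>i<d. emeasure lborel (A (p i)))"
      using A p by (intro prod.cong emeasure_lborel_sign) auto
    also have "\<dots> = (\<Prod>i<d. emeasure lborel (A i))"
      by (rule prod.reindex_bij_betw[OF bij_p])
    finally show "emeasure (distr (Pi\<^sub>M {..<d} (\<lambda>_. lborel)) (Pi\<^sub>M {..<d} (\<lambda>_. lborel)) ?T) (Pi\<^sub>E {..<d} A) =
        (\<Prod>i<d. emeasure lborel (A i))"
      unfolding P_def .
  qed simp_all
qed

lemma distr_lborel_vec: "distr (lborel_vec d) (borel_vec d) (signed_perm d s p) = lborel_vec d"
proof -
  let ?P = "\<Pi>\<^sub>M i\<in>{..<d}. lborel :: real measure"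
  let ?T = "\<lambda>x. \<lambda>i\<in>{..<d}. s i * x (p i)"
  note T = measurable_signed_perm_PiM
  have "distr (lborel_vec d) (borel_vec d) (signed_perm d s p) = distr ?P (borel_vec d) (signed_perm d s p \<circ> Matrix.vec d)"
    unfolding lborel_vec_def by (rule distr_distr) measurable
  also have "signed_perm d s p \<circ> Matrix.vec d = Matrix.vec d \<circ> ?T"
    using p by (auto simp: signed_perm_def fun_eq_iff)
  also have "distr ?P (borel_vec d) (Matrix.vec d \<circ> ?T) = distr (distr ?P ?P ?T) (borel_vec d) (Matrix.vec d)"
    by (intro distr_distr[symmetric] measurable_vec T)
  also have "\<dots> = lborel_vec d"
    unfolding distr_PiM_lborel lborel_vec_def ..
  finally show ?thesis .
qed

text \<open>The map preserves Lebesgue measure and the norm, hence the uniform law on the ball, and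
  it commutes with the radial projection.\<close>

lemma distr_unif_sphere: "distr (unif_sphere d) (borel_vec d) (signed_perm d s p) = unif_sphere d"
proof -
  let ?U = "uniform_measure (lborel_vec d) (unit_ball_vec d)"
  let ?N = "\<lambda>x. (1 / eucl_norm x) \<cdot>\<^sub>v x"
  have U: "distr ?U (borel_vec d) (signed_perm d s p) = ?U"
  proof (rule measure_eqI)
    fix A
    assume "A \<in> sets (distr ?U (borel_vec d) (signed_perm d s p))"
    then have A: "A \<in> sets (borel_vec d)"
      by simp
    let ?A' = "signed_perm d s p -` A \<inter> carrier_vec d"
    have A': "?A' \<in> sets (borel_vec d)"
      using measurable_sets[OF measurable_signed_perm A] by simp
    have "emeasure (distr ?U (borel_vec d) (signed_perm d s p)) A = emeasure ?U ?A'"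
      using A by (subst emeasure_distr) auto
    also have "\<dots> = emeasure (lborel_vec d) (unit_ball_vec d \<inter> ?A') / emeasure (lborel_vec d) (unit_ball_vec d)"
      using A' by (intro emeasure_uniform_measure) (auto simp: sets_lborel_vec)
    also have "unit_ball_vec d \<inter> ?A' = signed_perm d s p -` (unit_ball_vec d \<inter> A) \<inter> space (lborel_vec d)"
      by (auto simp: eucl_norm_signed_perm) (simp_all add: signed_perm_def)
    also have "emeasure (lborel_vec d) \<dots> =
        emeasure (distr (lborel_vec d) (borel_vec d) (signed_perm d s p)) (unit_ball_vec d \<inter> A)"
      using A by (intro emeasure_distr[symmetric]) (measurable, auto)
    also have "\<dots> = emeasure (lborel_vec d) (unit_ball_vec d \<inter> A)"
      by (simp add: distr_lborel_vec)
    also have "\<dots> / emeasure (lborel_vec d) (unit_ball_vec d) = emeasure ?U A"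
      using A by (intro emeasure_uniform_measure[symmetric]) (auto simp: sets_lborel_vec)
    finally show "emeasure (distr ?U (borel_vec d) (signed_perm d s p)) A = emeasure ?U A" .
  qed (simp add: sets_lborel_vec)
  have N: "?N \<in> ?U \<rightarrow>\<^sub>M borel_vec d"
    by measurable
  have S: "signed_perm d s p \<in> ?U \<rightarrow>\<^sub>M borel_vec d"
    by measurable
  have "distr (unif_sphere d) (borel_vec d) (signed_perm d s p) = distr ?U (borel_vec d) (signed_perm d s p \<circ> ?N)"
    unfolding unif_sphere_def using N by (intro distr_distr) measurable
  also have "\<dots> = distr ?U (borel_vec d) (?N \<circ> signed_perm d s p)"
  proof (rule distr_cong)
    fix x
    assume "x \<in> space ?U"
    then have x: "x \<in> carrier_vec d"
      by simp
    show "(signed_perm d s p \<circ> ?N) x = (?N \<circ> signed_perm d s p) x"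
      unfolding comp_def eucl_norm_signed_perm[OF x] using x p
      by (intro eq_vecI) (auto simp: signed_perm_def)
  qed auto
  also have "\<dots> = distr (distr ?U (borel_vec d) (signed_perm d s p)) (borel_vec d) ?N"
    using S by (intro distr_distr[symmetric]) measurable
  also have "\<dots> = unif_sphere d"
    unfolding U unif_sphere_def ..
  finally show ?thesis .
qed

lemma integral_unif_sphere:
  fixes f :: "real vec \<Rightarrow> real"
  assumes "f \<in> borel_measurable (borel_vec d)"
  shows "(\<integral>v. f (signed_perm d s p v) \<partial>unif_sphere d) = (\<integral>v. f v \<partial>unif_sphere d)"
proof -
  have "(\<integral>v. f v \<partial>unif_sphere d) = (\<integral>v. f v \<partial>distr (unif_sphere d) (borel_vec d) (signed_perm d s p))"
    by (simp add: distr_unif_sphere)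
  also have "\<dots> = (\<integral>v. f (signed_perm d s p v) \<partial>unif_sphere d)"
    using assms by (intro integral_distr) measurable
  finally show ?thesis ..
qed

end

text \<open>The measure \<open>unif_sphere d\<close> lives on all of \<open>\<real>\<^sup>d\<close>, so its points have norm at most \<open>1\<close> only almost
  surely; the truncation makes the bound hold everywhere.\<close>

definition unit_coord :: "real vec \<Rightarrow> nat \<Rightarrow> real" where
  "unit_coord v i = (if eucl_norm v \<le> 1 then v $ i else 0)"

text \<open>The origin is no exception: since \<open>1 / 0 = 0\<close>, it is sent to the zero
  vector. Asking for norm at most 1 instead of exactly 1 therefore needs no null set in the
  ball.\<close>

lemma AE_unif_sphere_norm_le: "AE v in unif_sphere d. eucl_norm v \<le> 1"
proof -
  have "{v \<in> space (borel_vec d). eucl_norm v \<le> 1} \<in> sets (borel_vec d)"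
    by measurable
  moreover have "y / \<bar>y\<bar> \<le> 1" for y :: real
    by (cases "y = 0") (auto simp: abs_if)
  ultimately show ?thesis
    unfolding unif_sphere_def
    by (subst AE_distr_iff) (auto simp: eucl_norm_smult[of _ d] intro!: AE_I2)
qed

lemma L2_set_unit_coord:
  assumes "v \<in> carrier_vec d"
  shows "L2_set (unit_coord v) {..<d} \<le> 1"
  using assms
  by (cases "eucl_norm v \<le> 1") (simp_all add: unit_coord_def[abs_def] eucl_norm_eq_L2_set[symmetric] L2_set_0')

lemma measurable_unit_coord:
  assumes "i < d"
  shows "(\<lambda>v. unit_coord v i) \<in> borel_measurable (unif_sphere d)"
  unfolding unit_coord_def using assms by measurable

lemma unit_coord_signed_perm:
  assumes "signed_involution d s p" "v \<in> carrier_vec d" "i < d"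
  shows "unit_coord (signed_perm d s p v) i = s i * unit_coord v (p i)"
  using assms signed_involution.eucl_norm_signed_perm[OF assms(1,2)]
  by (simp add: unit_coord_def signed_perm_def)

text \<open>Invariance of the law is specialised to second moments; suitable \<open>s\<close> and
  \<open>p\<close> then make covariances vanish or variances coincide.\<close>

lemma expectation_unit_coord_signed_perm:
  assumes si: "signed_involution d s p" and ij: "i < d" "j < d"
  shows "(\<integral>v. unit_coord v i * unit_coord v j \<partial>unif_sphere d) =
    s i * s j * (\<integral>v. unit_coord v (p i) * unit_coord v (p j) \<partial>unif_sphere d)"
proof -
  have meas: "(\<lambda>v. unit_coord v i * unit_coord v j) \<in> borel_measurable (borel_vec d)"
    using measurable_unit_coord[of _ d] ij by (simp add: measurable_cong_sets[OF sets_unif_sphere refl])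
  have "(\<integral>v. unit_coord v i * unit_coord v j \<partial>unif_sphere d) =
      (\<integral>v. unit_coord (signed_perm d s p v) i * unit_coord (signed_perm d s p v) j \<partial>unif_sphere d)"
    by (rule signed_involution.integral_unif_sphere[OF si meas, symmetric])
  also have "\<dots> = (\<integral>v. (s i * s j) * (unit_coord v (p i) * unit_coord v (p j)) \<partial>unif_sphere d)"
    by (rule Bochner_Integration.integral_cong) (simp_all add: unit_coord_signed_perm[OF si] ij mult_ac)
  finally show ?thesis
    by simp
qed

text \<open>Three symmetries suffice: negating all coordinates kills the mean, swapping coordinate
  \<open>i\<close> with coordinate 0 equates the variances, and changing the sign of one coordinate
  kills the remaining covariances.\<close>

theorem isotropic_unif_sphere:
  assumes d: "0 < d"
  shows "isotropic_unit_ball (unif_sphere d) {..<d} unit_coord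
    (\<integral>v. unit_coord v 0 * unit_coord v 0 \<partial>unif_sphere d)"
proof -
  interpret prob_space "unif_sphere d"
    by (rule prob_space_unif_sphere[OF d])
  show ?thesis
  proof
    fix i
    assume i: "i \<in> {..<d}"
    show "(\<lambda>v. unit_coord v i) \<in> borel_measurable (unif_sphere d)"
      using i by (simp add: measurable_unit_coord)
    have neg: "signed_involution d (\<lambda>_. - 1) (\<lambda>k. k)"
      by unfold_locales auto
    have meas: "(\<lambda>v. unit_coord v i) \<in> borel_measurable (borel_vec d)"
      using measurable_unit_coord[of i d] i by (simp add: measurable_cong_sets[OF sets_unif_sphere refl])
    have "expectation (\<lambda>v. unit_coord v i) =
        expectation (\<lambda>v. unit_coord (signed_perm d (\<lambda>_. - 1) (\<lambda>k. k) v) i)"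
      by (rule signed_involution.integral_unif_sphere[OF neg meas, symmetric])
    also have "\<dots> = expectation (\<lambda>v. - unit_coord v i)"
      using i by (intro Bochner_Integration.integral_cong) (simp_all add: unit_coord_signed_perm[OF neg])
    finally have "expectation (\<lambda>v. unit_coord v i) = expectation (\<lambda>v. - unit_coord v i)" .
    then show "expectation (\<lambda>v. unit_coord v i) = 0"
      by simp
  next
    fix i j
    assume ij: "i \<in> {..<d}" "j \<in> {..<d}"
    show "expectation (\<lambda>v. unit_coord v i * unit_coord v j) =
        (if i = j then expectation (\<lambda>v. unit_coord v 0 * unit_coord v 0) else 0)"
    proof (cases "i = j")
      case True
      have "signed_involution d (\<lambda>_. 1) (\<lambda>k. if k = i then 0 else if k = 0 then i else k)"
        using d ij by unfold_locales auto
      from expectation_unit_coord_signed_perm[OF this, of i i] ij True show ?thesis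
        by simp
    next
      case False
      have "signed_involution d (\<lambda>k. if k = i then - 1 else 1) (\<lambda>k. k)"
        by unfold_locales auto
      from expectation_unit_coord_signed_perm[OF this, of i j] ij False show ?thesis
        by simp
    qed
  qed (use d L2_set_unit_coord in auto)
qed

subsection \<open>Operator norm\<close>

lemma L2_set_mult_mat_vec:
  assumes "A \<in> carrier_mat m d" "x \<in> carrier_vec d"
  shows "eucl_norm (A *\<^sub>v x) = L2_set (\<lambda>i. \<Sum>j<d. A $$ (i, j) * x $ j) {..<m}"
  using assms
  by (subst eucl_norm_eq_L2_set[of _ m]) (auto simp: scalar_prod_def lessThan_atLeast0 intro!: L2_set_cong sum.cong)

text \<open>The supremum in \<open>op_norm\<close> carries information only once its set is known to
  be bounded above. The sum \<open>F\<close> of the row norms provides a crude bound; the rest is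
  scaling to unit norm.\<close>

lemma eucl_norm_mult_mat_vec_le:
  assumes A: "A \<in> carrier_mat m d" and x: "x \<in> carrier_vec d"
  shows "eucl_norm (A *\<^sub>v x) \<le> op_norm A * eucl_norm x"
proof -
  define F where "F = (\<Sum>i<m. L2_set (\<lambda>j. A $$ (i, j)) {..<d})"
  have F0: "0 \<le> F"
    by (simp add: F_def sum_nonneg)
  have crude: "eucl_norm (A *\<^sub>v y) \<le> F * eucl_norm y" if y: "y \<in> carrier_vec d" for y
  proof -
    have "eucl_norm (A *\<^sub>v y) \<le> (\<Sum>i<m. \<bar>\<Sum>j<d. A $$ (i, j) * y $ j\<bar>)"
      unfolding L2_set_mult_mat_vec[OF A y] by (rule L2_set_le_sum_abs)
    also have "\<dots> \<le> (\<Sum>i<m. L2_set (\<lambda>j. A $$ (i, j)) {..<d} * eucl_norm y)"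
      unfolding eucl_norm_eq_L2_set[OF y] by (intro sum_mono abs_sum_mult_le_L2_set)
    finally show ?thesis
      by (simp add: F_def sum_distrib_right)
  qed
  let ?S = "{eucl_norm (A *\<^sub>v x) | x. x \<in> carrier_vec (dim_col A) \<and> eucl_norm x \<le> 1}"
  have dim: "dim_col A = d"
    using A by simp
  have "bdd_above ?S"
  proof (rule bdd_aboveI)
    fix z
    assume "z \<in> ?S"
    then obtain y where y: "y \<in> carrier_vec d" "eucl_norm y \<le> 1" "z = eucl_norm (A *\<^sub>v y)"
      using dim by auto
    show "z \<le> F"
      using crude[OF y(1)] mult_left_mono[OF y(2) F0] y(3) by simp
  qed
  then have sup: "eucl_norm (A *\<^sub>v y) \<le> op_norm A" if "y \<in> carrier_vec d" "eucl_norm y \<le> 1" for y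
    unfolding op_norm_def using that dim by (intro cSup_upper) auto
  have nonneg: "0 \<le> eucl_norm x"
    by (simp add: eucl_norm_eq_L2_set[OF x])
  show ?thesis
  proof (cases "eucl_norm x = 0")
    \<comment> \<open>A vector of norm 0 cannot be normalised, but for it the crude bound already
      gives 0.\<close>
    case True
    then show ?thesis
      using crude[OF x] by simp
  next
    case False
    with nonneg have pos: "0 < eucl_norm x"
      by simp
    have "eucl_norm (A *\<^sub>v ((1 / eucl_norm x) \<cdot>\<^sub>v x)) \<le> op_norm A"
      using x pos by (intro sup) (auto simp: eucl_norm_smult[OF x])
    moreover have "eucl_norm (A *\<^sub>v ((1 / eucl_norm x) \<cdot>\<^sub>v x)) = eucl_norm (A *\<^sub>v x) / eucl_norm x"
      using pos A x by (simp add: mult_mat_vec[OF A x] eucl_norm_smult[of _ m])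
    ultimately show ?thesis
      using pos by (simp add: divide_le_eq)
  qed
qed

text \<open>A matrix and its transpose have the same operator norm: for
  \<open>w = A\<^sup>T x\<close>, \<open>\<parallel>w\<parallel>\<^sup>2 = \<langle>x, A w\<rangle>
  \<le> \<parallel>w\<parallel>\<close>, and one factor cancels.\<close>

lemma L2_set_transpose_mult_le:
  assumes A: "A \<in> carrier_mat d d" "op_norm A \<le> 1" and x: "L2_set x {..<d} \<le> 1"
  shows "L2_set (\<lambda>l. \<Sum>m<d. A $$ (m, l) * x m) {..<d} \<le> 1"
proof -
  define w where "w = Matrix.vec d (\<lambda>l. \<Sum>m<d. A $$ (m, l) * x m)"
  have w: "w \<in> carrier_vec d"
    by (simp add: w_def)
  define N where "N = eucl_norm w"
  have N: "N = L2_set (\<lambda>l. \<Sum>m<d. A $$ (m, l) * x m) {..<d}"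
    unfolding N_def eucl_norm_eq_L2_set[OF w] by (intro L2_set_cong) (auto simp: w_def)
  have N0: "0 \<le> N"
    by (simp add: N)
  have "N\<^sup>2 = (\<Sum>l<d. (\<Sum>m<d. A $$ (m, l) * x m) * w $ l)"
    unfolding N L2_set_power2 by (intro sum.cong) (auto simp: w_def power2_eq_square)
  also have "\<dots> = (\<Sum>l<d. \<Sum>m<d. x m * (A $$ (m, l) * w $ l))"
    by (simp add: sum_distrib_left sum_distrib_right mult_ac)
  also have "\<dots> = (\<Sum>m<d. x m * (\<Sum>l<d. A $$ (m, l) * w $ l))"
    by (subst sum.swap) (simp add: sum_distrib_left)
  also have "\<dots> \<le> L2_set x {..<d} * eucl_norm (A *\<^sub>v w)"
    unfolding L2_set_mult_mat_vec[OF A(1) w] by (rule order_trans[OF abs_ge_self abs_sum_mult_le_L2_set])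
  also have "\<dots> \<le> 1 * (1 * N)"
    using x A N0 eucl_norm_mult_mat_vec_le[OF A(1) w] mult_right_mono[OF A(2) N0]
    by (intro mult_mono) (auto simp: N_def L2_set_mult_mat_vec[OF A(1) w])
  finally have "N * N \<le> 1 * N"
    by (simp add: power2_eq_square)
  then have "N \<le> 1"
    using N0 by (cases "N = 0") auto
  then show ?thesis
    by (simp add: N)
qed

subsection \<open>The attention vector\<close>

text \<open>The product \<open>Q\<^sup>T K\<close> is bounded, not \<open>Q\<close> and
  \<open>K\<close> separately, so both matrices are moved onto \<open>\<theta> j\<close>: the
  coefficient of \<open>\<theta> k $ l\<close> is a coordinate of
  \<open>(Q\<^sup>T K)\<^sup>T \<theta>\<^sub>j\<close>.\<close>

lemma attn_weight_eq:
  assumes "Q \<in> carrier_mat d d" "K \<in> carrier_mat d d" "\<theta> j \<in> carrier_vec d" "\<theta> k \<in> carrier_vec d"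
  shows "attn_weight 1 Q K \<theta> j k =
    exp (\<Sum>l<d. (\<Sum>m<d. (transpose_mat Q * K) $$ (m, l) * \<theta> j $ m) * \<theta> k $ l)"
proof -
  let ?A = "transpose_mat Q * K"
  have A: "?A \<in> carrier_mat d d"
    using assms by simp
  have "(Q *\<^sub>v \<theta> j) \<bullet> (K *\<^sub>v \<theta> k) = (K *\<^sub>v \<theta> k) \<bullet> (Q *\<^sub>v \<theta> j)"
    using assms by (intro comm_scalar_prod[of _ d]) auto
  also have "\<dots> = (transpose_mat Q *\<^sub>v (K *\<^sub>v \<theta> k)) \<bullet> \<theta> j"
    using assms by (intro transpose_vec_mult_scalar[symmetric, of _ d d]) auto
  also have "transpose_mat Q *\<^sub>v (K *\<^sub>v \<theta> k) = ?A *\<^sub>v \<theta> k"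
    using assms by (intro assoc_mult_mat_vec[symmetric, of _ d d _ d]) auto
  also have "(?A *\<^sub>v \<theta> k) \<bullet> \<theta> j = (\<Sum>m<d. (\<Sum>l<d. ?A $$ (m, l) * \<theta> k $ l) * \<theta> j $ m)"
    using A assms(3,4) unfolding scalar_prod_def
    by (auto simp: scalar_prod_def lessThan_atLeast0 simp del: index_mult_mat intro!: sum.cong)
  also have "\<dots> = (\<Sum>l<d. (\<Sum>m<d. ?A $$ (m, l) * \<theta> j $ m) * \<theta> k $ l)"
    by (simp only: sum_distrib_right, subst sum.swap) (simp add: mult_ac del: index_mult_mat)
  finally show ?thesis
    by (simp add: attn_weight_def)
qed

text \<open>By linearity \<open>V\<close> comes out of the weighted average, so that only averages
  of the \<open>\<theta> k\<close> themselves remain to be estimated.\<close>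

lemma attn_eq:
  assumes V: "V \<in> carrier_mat d d" and \<theta>: "\<And>k. k \<in> {1..n} \<Longrightarrow> \<theta> k \<in> carrier_vec d"
  shows "attn \<beta> Q K V n \<theta> j =
    V *\<^sub>v Matrix.vec d (\<lambda>i. (\<Sum>k=1..n. attn_weight \<beta> Q K \<theta> j k * \<theta> k $ i) / (\<Sum>k=1..n. attn_weight \<beta> Q K \<theta> j k))"
    (is "_ = V *\<^sub>v ?u")
proof (rule eq_vecI)
  let ?a = "attn_weight \<beta> Q K \<theta> j" and ?Z = "attn_Z \<beta> Q K n \<theta> j"
  have fin: "finsum_vec TYPE(real) d (\<lambda>k. ?a k \<cdot>\<^sub>v (V *\<^sub>v \<theta> k)) {1..n} \<in> carrier_vec d"
    using V \<theta> by (intro finsum_vec_closed) auto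
  show "dim_vec (attn \<beta> Q K V n \<theta> j) = dim_vec (V *\<^sub>v ?u)"
    using V fin by (simp add: attn_def)
  fix i
  assume "i < dim_vec (V *\<^sub>v ?u)"
  then have i: "i < d"
    using V by simp
  have "attn \<beta> Q K V n \<theta> j $ i = (1 / ?Z) * (\<Sum>k=1..n. (?a k \<cdot>\<^sub>v (V *\<^sub>v \<theta> k)) $ i)"
    using V fin i \<theta> by (auto simp: attn_def index_finsum_vec)
  also have "\<dots> = (1 / ?Z) * (\<Sum>k=1..n. ?a k * (\<Sum>l<d. V $$ (i, l) * \<theta> k $ l))"
  proof -
    have "(?a k \<cdot>\<^sub>v (V *\<^sub>v \<theta> k)) $ i = ?a k * (\<Sum>l<d. V $$ (i, l) * \<theta> k $ l)" if "k \<in> {1..n}" for k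
      using V i \<theta>[OF that] by (auto simp: scalar_prod_def lessThan_atLeast0 intro!: sum.cong)
    then show ?thesis
      by simp
  qed
  also have "\<dots> = (\<Sum>k=1..n. \<Sum>l<d. V $$ (i, l) * (?a k * \<theta> k $ l / ?Z))"
    by (simp add: sum_distrib_left mult_ac)
  also have "\<dots> = (\<Sum>l<d. V $$ (i, l) * ((\<Sum>k=1..n. ?a k * \<theta> k $ l) / ?Z))"
    by (subst sum.swap) (simp add: sum_distrib_left sum_divide_distrib)
  also have "\<dots> = (V *\<^sub>v ?u) $ i"
    using V i by (auto simp: scalar_prod_def lessThan_atLeast0 attn_Z_def intro!: sum.cong)
  finally show "attn \<beta> Q K V n \<theta> j $ i = (V *\<^sub>v ?u) $ i" .
qed

lemma eucl_norm_attn_le: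
  assumes V: "V \<in> carrier_mat d d" "op_norm V \<le> 1" and \<theta>: "\<And>k. k \<in> {1..n} \<Longrightarrow> \<theta> k \<in> carrier_vec d"
  shows "eucl_norm (attn \<beta> Q K V n \<theta> j) \<le>
    L2_set (\<lambda>i. (\<Sum>k=1..n. attn_weight \<beta> Q K \<theta> j k * \<theta> k $ i) / (\<Sum>k=1..n. attn_weight \<beta> Q K \<theta> j k)) {..<d}"
proof -
  let ?u = "Matrix.vec d (\<lambda>i. (\<Sum>k=1..n. attn_weight \<beta> Q K \<theta> j k * \<theta> k $ i) / (\<Sum>k=1..n. attn_weight \<beta> Q K \<theta> j k))"
  have u: "?u \<in> carrier_vec d"
    by simp
  have norm_u: "eucl_norm ?u =
    L2_set (\<lambda>i. (\<Sum>k=1..n. attn_weight \<beta> Q K \<theta> j k * \<theta> k $ i) / (\<Sum>k=1..n. attn_weight \<beta> Q K \<theta> j k)) {..<d}"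
    unfolding eucl_norm_eq_L2_set[OF u] by (intro L2_set_cong) auto
  have eq: "attn \<beta> Q K V n \<theta> j = V *\<^sub>v ?u"
    using V(1) \<theta> by (rule attn_eq)
  have "eucl_norm (attn \<beta> Q K V n \<theta> j) \<le> op_norm V * eucl_norm ?u"
    unfolding eq by (rule eucl_norm_mult_mat_vec_le[OF V(1) u])
  also have "\<dots> \<le> 1 * eucl_norm ?u"
    unfolding norm_u by (intro mult_right_mono V) auto
  finally show ?thesis
    by (simp only: norm_u mult_1)
qed

text \<open>The almost sure comparison of events in \<open>attn_concentration\<close> requires the
  target event to be measurable. On the underlying space the norm is an explicit expression in the
  coordinates of the \<open>\<theta> k\<close>.\<close>

lemma measurable_eucl_norm_attn:
  assumes QKV: "Q \<in> carrier_mat d d" "K \<in> carrier_mat d d" "V \<in> carrier_mat d d" and j: "j \<in> {1..n}"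
  shows "(\<lambda>\<theta>. eucl_norm (attn 1 Q K V n \<theta> j)) \<in> borel_measurable (iid_sphere d n)"
proof -
  let ?A = "transpose_mat Q * K"
  define a where "a \<theta> k = exp (\<Sum>l<d. (\<Sum>m<d. ?A $$ (m, l) * \<theta> j $ m) * \<theta> k $ l)" for \<theta> :: "nat \<Rightarrow> real vec" and k
  have coord: "(\<lambda>\<theta>. \<theta> k $ l) \<in> borel_measurable (iid_sphere d n)" if "k \<in> {1..n}" "l < d" for k l
  proof -
    have "(\<lambda>v. v $ l) \<in> borel_measurable (unif_sphere d)"
      using that(2) by measurable
    from measurable_compose[OF measurable_component_singleton[OF that(1)] this] show ?thesis
      unfolding iid_sphere_def .
  qed
  have a: "(\<lambda>\<theta>. a \<theta> k) \<in> borel_measurable (iid_sphere d n)" if "k \<in> {1..n}" for k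
    unfolding a_def using that j
    by (intro measurable_compose[OF _ borel_measurable_exp] borel_measurable_sum borel_measurable_times
        borel_measurable_const coord) auto
  have "(\<lambda>\<theta>. L2_set (\<lambda>i. \<Sum>l<d. V $$ (i, l) * ((\<Sum>k=1..n. a \<theta> k * \<theta> k $ l) / (\<Sum>k=1..n. a \<theta> k))) {..<d})
      \<in> borel_measurable (iid_sphere d n)"
    by (intro measurable_L2_set borel_measurable_sum borel_measurable_times borel_measurable_divide
        borel_measurable_const a coord) auto
  then show ?thesis
  proof (rule measurable_cong[THEN iffD1, rotated])
    fix \<theta>
    assume "\<theta> \<in> space (iid_sphere d n)"
    then have \<theta>: "\<theta> k \<in> carrier_vec d" if "k \<in> {1..n}" for k
      using that by (auto simp: iid_sphere_def space_PiM PiE_iff)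
    have w: "attn_weight 1 Q K \<theta> j k = a \<theta> k" if "k \<in> {1..n}" for k
      unfolding a_def by (rule attn_weight_eq[OF QKV(1,2) \<theta>[OF j] \<theta>[OF that]])
    show "L2_set (\<lambda>i. \<Sum>l<d. V $$ (i, l) * ((\<Sum>k=1..n. a \<theta> k * \<theta> k $ l) / (\<Sum>k=1..n. a \<theta> k))) {..<d} =
        eucl_norm (attn 1 Q K V n \<theta> j)"
      using attn_eq[OF QKV(3), of n \<theta> 1 Q K j] \<theta>
      by (simp, subst L2_set_mult_mat_vec[OF QKV(3)]) (auto simp: w)
  qed
qed

text \<open>This is \<open>softmax_average_concentration\<close> with \<open>W v\<close> equal to
  \<open>(Q\<^sup>T K)\<^sup>T v\<close> in truncated coordinates. The variance bound turns
  \<open>9 * \<sigma>\<close> into \<open>9 / d\<close>.\<close>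

theorem attn_concentration:
  assumes d: "0 < d" and n: "0 < n" and t: "0 \<le> t"
    and QKV: "Q \<in> carrier_mat d d" "K \<in> carrier_mat d d" "V \<in> carrier_mat d d"
    and op: "op_norm (transpose_mat Q * K) \<le> 1" "op_norm V \<le> 1"
    and B: "9 / real n + 3 * t / real n + 9 / real d \<le> B"
  shows "1 - 2 * real n * exp (- t\<^sup>2 / (72 * real n)) \<le> measure (iid_sphere d n)
    {\<theta> \<in> space (iid_sphere d n). \<forall>j\<in>{1..n}. eucl_norm (attn 1 Q K V n \<theta> j) \<le> B}"
proof -
  let ?A = "transpose_mat Q * K"
  let ?\<sigma> = "\<integral>v. unit_coord v 0 * unit_coord v 0 \<partial>unif_sphere d"
  interpret iso: isotropic_unit_ball "unif_sphere d" "{..<d}" unit_coord ?\<sigma>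
    by (rule isotropic_unif_sphere[OF d])
  interpret P: prob_space "iid_sphere d n"
    unfolding iid_sphere_def by (rule prob_space_PiM) (rule iso.prob_space_axioms)
  have A: "?A \<in> carrier_mat d d"
    using QKV by simp
  define W where "W v l = (\<Sum>m<d. ?A $$ (m, l) * unit_coord v m)" for v l
  define a where "a \<theta> j k = exp (\<Sum>l<d. W (\<theta> j) l * unit_coord (\<theta> k) l)" for \<theta> :: "nat \<Rightarrow> real vec" and j k
  have W: "(\<lambda>v. W v l) \<in> borel_measurable (unif_sphere d)" for l
    unfolding W_def by (intro borel_measurable_sum borel_measurable_times borel_measurable_const measurable_unit_coord) auto
  have W_le: "L2_set (W v) {..<d} \<le> 1" if "v \<in> space (unif_sphere d)" for v
    using that unfolding W_def[abs_def]
    by (intro L2_set_transpose_mult_le[OF A op(1)] L2_set_unit_coord) simp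
  have "?\<sigma> \<le> 1 / real d"
    using iso.card_mult_variance_le_1 d by (simp add: field_simps)
  then have le_B: "9 / real n + 3 * t / real n + 9 * ?\<sigma> \<le> B"
    using B by simp
  let ?good = "{\<theta> \<in> space (iid_sphere d n). \<forall>j\<in>{1..n}.
      L2_set (\<lambda>i. (\<Sum>k=1..n. a \<theta> j k * unit_coord (\<theta> k) i) / (\<Sum>k=1..n. a \<theta> j k)) {..<d}
        \<le> 9 / real n + 3 * t / real n + 9 * ?\<sigma>}"
  let ?target = "{\<theta> \<in> space (iid_sphere d n). \<forall>j\<in>{1..n}. eucl_norm (attn 1 Q K V n \<theta> j) \<le> B}"
  have "1 - 2 * real n * exp (- t\<^sup>2 / (72 * real n)) \<le> measure (iid_sphere d n) ?good"
    using iso.softmax_average_concentration[OF W W_le _ _ t, of "{1..n}"] n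
    by (simp add: a_def iid_sphere_def)
  also have "\<dots> \<le> measure (iid_sphere d n) ?target"
  \<comment> \<open>Almost surely all \<open>\<theta> k\<close> lie in the unit ball, where
    \<open>unit_coord\<close> agrees with the true coordinates.\<close>
  proof (rule P.finite_measure_mono_AE)
    have "AE \<theta> in iid_sphere d n. \<forall>k\<in>{1..n}. eucl_norm (\<theta> k) \<le> 1"
      unfolding iid_sphere_def
      by (intro AE_finite_allI AE_PiM_component iso.prob_space_axioms AE_unif_sphere_norm_le) auto
    then show "AE \<theta> in iid_sphere d n. \<theta> \<in> ?good \<longrightarrow> \<theta> \<in> ?target"
    proof eventually_elim
      case (elim \<theta>)
      have "eucl_norm (attn 1 Q K V n \<theta> j) \<le> B" if good: "\<theta> \<in> ?good" and j: "j \<in> {1..n}" for j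
      proof -
        have \<theta>: "\<theta> k \<in> carrier_vec d" if "k \<in> {1..n}" for k
          using good that by (auto simp: iid_sphere_def space_PiM PiE_iff)
        have uc: "unit_coord (\<theta> k) i = \<theta> k $ i" if "k \<in> {1..n}" for k i
          using elim that by (simp add: unit_coord_def)
        have w: "attn_weight 1 Q K \<theta> j k = a \<theta> j k" if "k \<in> {1..n}" for k
          unfolding attn_weight_eq[OF QKV(1,2) \<theta>[OF j] \<theta>[OF that]] a_def W_def
          by (simp only: uc[OF j] uc[OF that])
        have "eucl_norm (attn 1 Q K V n \<theta> j) \<le> L2_set (\<lambda>i. (\<Sum>k=1..n. attn_weight 1 Q K \<theta> j k * \<theta> k $ i) /
            (\<Sum>k=1..n. attn_weight 1 Q K \<theta> j k)) {..<d}"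
          using QKV(3) op(2) \<theta> by (rule eucl_norm_attn_le)
        also have "\<dots> = L2_set (\<lambda>i. (\<Sum>k=1..n. a \<theta> j k * unit_coord (\<theta> k) i) / (\<Sum>k=1..n. a \<theta> j k)) {..<d}"
          by (intro L2_set_cong refl arg_cong2[where f = "(/)"] sum.cong) (simp_all only: w uc)
        also have "\<dots> \<le> B"
          using good j le_B by fastforce
        finally show ?thesis .
      qed
      then show ?case
        by blast
    qed
    have [measurable]: "(\<lambda>\<theta>. eucl_norm (attn 1 Q K V n \<theta> j)) \<in> borel_measurable (iid_sphere d n)"
      if "j \<in> {1..n}" for j
      by (rule measurable_eucl_norm_attn[OF QKV that])
    show "?target \<in> sets (iid_sphere d n)"
      by measurable
  qed
  finally show ?thesis .
qed

section \<open>Choice of the deviation level and of the absolute constant\<close>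

theorem theorem4p2:
  shows "\<exists>C::real. C > 0 \<and>
    (\<forall>(d::nat) (n::nat) (Q::real mat) (K::real mat) (V::real mat).
       d > 0 \<longrightarrow> n > 0 \<longrightarrow>
       exp (sqrt (real d)) \<ge> real n * ln (real n) \<longrightarrow> real n * ln (real n) \<ge> real d \<longrightarrow>
       Q \<in> carrier_mat d d \<longrightarrow> K \<in> carrier_mat d d \<longrightarrow> V \<in> carrier_mat d d \<longrightarrow>
       max (op_norm (transpose_mat Q * K)) (op_norm V) \<le> 1 \<longrightarrow>
       measure (iid_sphere d n)
         {\<theta> \<in> space (iid_sphere d n). \<forall>j\<in>{1..n}.
            eucl_norm (attn 1 Q K V n \<theta> j)
              \<le> C * (sqrt (ln (real n) / real n) + ln (real n) / real d)}
         \<ge> 1 - real n powr (- C))"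
proof (rule exI[of _ 729], intro conjI allI impI)
  fix d n :: nat and Q K V :: "real mat"
  assume d: "0 < d" and n: "0 < n" and nd: "real d \<le> real n * ln (real n)"
    and QKV: "Q \<in> carrier_mat d d" "K \<in> carrier_mat d d" "V \<in> carrier_mat d d"
    and op: "max (op_norm (transpose_mat Q * K)) (op_norm V) \<le> 1"
  define L where "L = ln (real n)"
  \<comment> \<open>A single constant must serve as prefactor and as exponent. With
    \<open>t = c * sqrt (n * L)\<close> the estimates below yield the prefactor
    \<open>9 + 3 * c\<close> and the exponent \<open>c\<^sup>2 / 72 - 2\<close>;
    \<open>c = 240\<close> gives 729 and 798.\<close>
  define t where "t = 240 * sqrt (real n * L)"
  \<comment> \<open>At \<open>n = 1\<close> the product \<open>n * ln n\<close> is 0, hence below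
    \<open>d\<close>. From \<open>n \<ge> 2\<close> on, \<open>L\<close> is bounded away from 0,
    which is what absorbs the terms \<open>9 / n\<close> and \<open>9 / d\<close>.\<close>
  have "n \<noteq> 1"
    using d nd by auto
  with n have n2: "2 \<le> real n"
    by simp
  then have "ln 2 \<le> L"
    unfolding L_def by (subst ln_le_cancel_iff) auto
  with ln2_ge_two_thirds have L: "1 / 2 \<le> L"
    by simp
  have "9 / real n + 3 * t / real n + 9 / real d \<le> 729 * (sqrt (L / real n) + L / real d)"
  proof -
    have "1 / real n \<le> sqrt (L / real n)"
    proof (rule real_le_rsqrt)
      have "1 / real n \<le> L"
        using n2 L by (intro order_trans[of "1 / real n" "1 / 2" L]) (auto simp: field_simps)
      then have "1 / real n / real n \<le> L / real n"
        by (rule divide_right_mono) simp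
      then show "(1 / real n)\<^sup>2 \<le> L / real n"
        by (simp add: power2_eq_square)
    qed
    moreover have "t / real n = 240 * sqrt (L / real n)"
    proof -
      have "sqrt (real n * L) / real n = sqrt (real n * L) / sqrt ((real n)\<^sup>2)"
        by simp
      also have "\<dots> = sqrt (real n * L / (real n)\<^sup>2)"
        by (rule real_sqrt_divide[symmetric])
      also have "real n * L / (real n)\<^sup>2 = L / real n"
        using n by (simp add: power2_eq_square)
      finally show ?thesis
        by (simp add: t_def)
    qed
    moreover have "1 / real d \<le> 2 * (L / real d)"
      using divide_right_mono[of 1 "2 * L" "real d"] L by simp
    moreover have "0 \<le> L / real d"
      using L by simp
    ultimately show ?thesis
      by simp
  qed
  then have "1 - 2 * real n * exp (- t\<^sup>2 / (72 * real n)) \<le> measure (iid_sphere d n)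
      {\<theta> \<in> space (iid_sphere d n). \<forall>j\<in>{1..n}.
         eucl_norm (attn 1 Q K V n \<theta> j) \<le> 729 * (sqrt (L / real n) + L / real d)}"
    using L op by (intro attn_concentration d n QKV) (auto simp: t_def)
  moreover have "2 * real n * exp (- t\<^sup>2 / (72 * real n)) \<le> real n powr (- 729)"
  proof -
    have "t\<^sup>2 = 57600 * (real n * L)"
      using L by (simp add: t_def power_mult_distrib)
    then have "- t\<^sup>2 / (72 * real n) = (- 800) * L"
      using n by (simp add: field_simps)
    then have "exp (- t\<^sup>2 / (72 * real n)) = real n powr (- 800)"
      using n by (simp add: powr_def L_def)
    \<comment> \<open>The factor 2 is absorbed into a second factor \<open>n\<close>, since
      \<open>n \<ge> 2\<close>.\<close>
    then have "2 * real n * exp (- t\<^sup>2 / (72 * real n)) \<le> real n * real n * real n powr (- 800)"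
      using n2 by (auto intro!: mult_right_mono)
    also have "\<dots> = real n powr 1 * real n powr 1 * real n powr (- 800)"
      using n by simp
    also have "\<dots> = real n powr (1 + 1 + - 800)"
      by (simp only: powr_add)
    also have "\<dots> \<le> real n powr (- 729)"
      using n2 by (intro powr_mono) auto
    finally show ?thesis .
  qed
  ultimately show "1 - real n powr (- 729) \<le> measure (iid_sphere d n)
      {\<theta> \<in> space (iid_sphere d n). \<forall>j\<in>{1..n}. eucl_norm (attn 1 Q K V n \<theta> j)
         \<le> 729 * (sqrt (ln (real n) / real n) + ln (real n) / real d)}"
    unfolding L_def by linarith
qed simp

end
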